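(* Let $\mathcal S$ be a locally compact Hausdorff space, let $\mu$ be a content on $\mathfrak R(\mathcal S)$, and let $\overline{\mathcal S}$ be a compactification of $\mathcal S$. There is a unique normal Borel measure $\overline\nu$ on $\overline{\mathcal S}$, and a unique liminal density structure $\{\overline\phi_Q\}_{Q\in\mathfrak R(\overline{\mathcal S})}$ on $\overline{\mathcal S}$ which is subordinate to $\overline\nu$, such that for any $R\in\mathfrak R(\mathcal S)$, $$\mu[R]=\overline\nu(\overline R)+\int_{\partial\overline R}\overline\phi_{\overline R}\,d\overline\nu,$$ where $\overline R$ is the unique extension of $R$ to $\overline{\mathcal S}$. Furthermore, for any $R\in\mathfrak R(\mathcal S)$ and any $f\in\mathcal C_{\overline{\mathcal S}}(\mathcal S,\mathbb R)$, $$\fint_R f\,d\mu=\int_{\overline R}\overline f\,d\overline\nu+\int_{\partial\overline R}\overline f\,\overline\phi_{\overline R}\,d\overline\nu,$$ where $\overline f$ is the unique extension of $f$ to $\mathcal C(\overline{\mathcal S},\mathbb R)$.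
   Context: A compactification of $\mathcal S$ is a compact Hausdorff space $\overline{\mathcal S}$ containing $\mathcal S$ as a dense subspace. $\mathcal C_{\overline{\mathcal S}}(\mathcal S,\mathbb R):=\{h|_{\mathcal S}: h\in\mathcal C(\overline{\mathcal S},\mathbb R)\}$ is the set of continuous functions on $\mathcal S$ that extend continuously to $\overline{\mathcal S}$ (the extension $\overline f$ is unique by density). For a topological space $\mathcal T$, an open set $R\subseteq\mathcal T$ is regular if $R=\mathrm{int}(\mathrm{clos}(R))$. $\mathfrak R(\mathcal T)$ is the set of regular open subsets; it is a Boolean algebra with meet $\cap$, join $Q\vee R:=\mathrm{int}(\mathrm{clos}(Q\cup R))$ and complement $\neg R:=\mathrm{int}(\mathcal T\setminus R)$. For every $R\in\mathfrak R(\mathcal S)$ there is a unique $\overline R\in\mathfrak R(\overline{\mathcal S})$ with $\overline R\cap\mathcal S=R$, called the extension of $R$; $\partial\overline R$ is its boundary in $\overline{\mathcal S}$. A content on $\mathfrak R(\mathcal S)$ is a function $\mu:\mathfrak R(\mathcal S)\to[0,\infty)$ such that $\mu[R_1\vee\cdots\vee R_N]=\sum_n\mu[R_n]$ for every finite collection of disjoint regular open sets; by standing assumption $\mu[\mathcal S]=1$. A regular partition of $\mathcal T$ is a finite collection of disjoint elements of $\mathfrak R(\mathcal T)$ with join $\mathcal T$. Integral against a content on $\mathfrak R(\mathcal S)$: call $f:\mathcal S\to\mathbb R$ simple if it is constant on each cell of some regular partition of $\mathcal S$ (values off the cells are arbitrary). For $R\in\mathfrak R(\mathcal S)$ and bounded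 simple $f$ with value $r_n$ on the cell $P_n$, $\fint_R f\,d\mu:=\sum_n r_n\mu[P_n\cap R]$. Every bounded continuous $g:\mathcal S\to\mathbb R$ is a uniform limit of simple functions, and $\fint_R g\,d\mu$ is the supremum of $\fint_R f\,d\mu$ over all bounded simple $f$ with $f\le g$ on $R$. A Borel measure $\nu$ is normal if for every Borel set $B$, $\nu[B]=\sup\{\nu[C]: C\subseteq B,\ C\text{ closed}\}$ and $\nu[B]=\inf\{\nu[O]: B\subseteq O,\ O\text{ open}\}$. Given a Borel measure $\nu$ on a space $\mathcal T$, a liminal density structure subordinate to $\nu$ is a collection $\{\phi_R\}_{R\in\mathfrak R(\mathcal T)}$, where $\phi_R\in L^1(\partial R,\nu;[0,1])$ is (the $\nu$-a.e. class of) a $[0,1]$-valued $\nu$-integrable function on $\partial R$, such that for every regular partition $\{R_1,\dots,R_N\}$ of $\mathcal T$, $\phi_{R_1}+\cdots+\phi_{R_N}=1$ $\nu$-almost everywhere on $\partial R_1\cup\cdots\cup\partial R_N$ (each $\phi_{R_n}$ being extended by $0$ off $\partial R_n$). *)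

theory Defs
  imports "HOL-Analysis.Analysis"
begin

section \<open>Compactifications\<close>

text \<open>The space and its compactification are topologies over one type, so that the former is
  literally a dense subspace of the latter.\<close>

definition compactification :: "'a topology \<Rightarrow> 'a topology \<Rightarrow> bool" where
  "compactification X Y \<longleftrightarrow>
     compact_space Y \<and> Hausdorff_space Y \<and>
     topspace X \<subseteq> topspace Y \<and> X = subtopology Y (topspace X) \<and>
     Y closure_of (topspace X) = topspace Y"

definition extendable_functions :: "'a topology \<Rightarrow> 'a topology \<Rightarrow> ('a \<Rightarrow> real) set" where
  "extendable_functions X Y = {restrict h (topspace X) | h. continuous_map Y euclideanreal h}"

text \<open>Functions on a space are represented by extensional functions; this makes the
  continuous extension unique as a HOL function.\<close>

definition fun_extension :: "'a topology \<Rightarrow> 'a topology \<Rightarrow> ('a \<Rightarrow> real) \<Rightarrow> 'a \<Rightarrow> real" where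
  "fun_extension X Y f =
     (THE h. continuous_map Y euclideanreal h \<and> h \<in> extensional (topspace Y) \<and>
             restrict h (topspace X) = f)"

lemma fun_extension_ex1:
  assumes c: "compactification X Y" and f: "f \<in> extendable_functions X Y"
  shows "\<exists>!h. continuous_map Y euclideanreal h \<and> h \<in> extensional (topspace Y) \<and>
              restrict h (topspace X) = f"
proof -
  have sub: "topspace X \<subseteq> topspace Y" and dense: "Y closure_of (topspace X) = topspace Y"
    using c by (auto simp: compactification_def)
  obtain h where h: "continuous_map Y euclideanreal h" "f = restrict h (topspace X)"
    using f by (auto simp: extendable_functions_def)
  show ?thesis
  proof (rule ex1I[of _ "restrict h (topspace Y)"])
    show "continuous_map Y euclideanreal (restrict h (topspace Y)) \<and>
          restrict h (topspace Y) \<in> extensional (topspace Y) \<and>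
          restrict (restrict h (topspace Y)) (topspace X) = f"
      using h sub by (auto simp: Int_absorb1 intro: continuous_map_eq)
  next
    fix g assume g: "continuous_map Y euclideanreal g \<and> g \<in> extensional (topspace Y) \<and>
                     restrict g (topspace X) = f"
    have eq: "g x = h x" if "x \<in> topspace X" for x
      using g h(2) that by (metis restrict_apply')
    have "g x = h x" if "x \<in> topspace Y" for x
      by (rule forall_in_closure_of_eq[where X=Y and Y=euclideanreal and S="topspace X"])
         (use that dense g h eq in auto)
    then show "g = restrict h (topspace Y)"
      using g by (intro extensionalityI[of _ "topspace Y"]) auto
  qed
qed

section \<open>Regular open sets\<close>

definition regular_opens :: "'a topology \<Rightarrow> 'a set set" where
  "regular_opens T = {R. openin T R \<and> R = T interior_of (T closure_of R)}"

text \<open>The join of a collection of regular open sets; for two sets this is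
  \<open>int (clos (Q \<union> R))\<close>, and finite joins are iterated binary joins
  (lemma \<open>regular_join_insert\<close>).\<close>

definition regular_join :: "'a topology \<Rightarrow> 'a set set \<Rightarrow> 'a set" where
  "regular_join T \<R> = T interior_of (T closure_of (\<Union>\<R>))"

definition regular_partition :: "'a topology \<Rightarrow> 'a set set \<Rightarrow> bool" where
  "regular_partition T \<P> \<longleftrightarrow>
     finite \<P> \<and> \<P> \<subseteq> regular_opens T \<and> disjoint \<P> \<and> regular_join T \<P> = topspace T"

definition regular_extension :: "'a topology \<Rightarrow> 'a topology \<Rightarrow> 'a set \<Rightarrow> 'a set" where
  "regular_extension X Y R = (THE Q. Q \<in> regular_opens Y \<and> Q \<inter> topspace X = R)"

lemma interior_closure_in_regular_opens: "T interior_of (T closure_of A) \<in> regular_opens T"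
proof -
  let ?R = "T interior_of (T closure_of A)"
  have "T closure_of ?R \<subseteq> T closure_of A"
    by (metis closure_of_closure_of closure_of_mono interior_of_subset)
  then have "T interior_of (T closure_of ?R) \<subseteq> ?R"
    by (rule interior_of_mono)
  moreover have "?R \<subseteq> T interior_of (T closure_of ?R)"
    by (simp add: closure_of_subset interior_of_maximal interior_of_subset_topspace)
  ultimately show ?thesis
    by (auto simp: regular_opens_def)
qed

lemma regular_join_insert:
  assumes "\<R> \<subseteq> regular_opens T"
  shows "regular_join T (insert Q \<R>) = regular_join T {Q, regular_join T \<R>}"
proof -
  have "openin T R" if "R \<in> \<R>" for R
    using assms that by (auto simp: regular_opens_def)
  then have op: "openin T (\<Union>\<R>)"
    by blast
  have sub: "\<Union>\<R> \<subseteq> T interior_of (T closure_of (\<Union>\<R>))"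
    by (simp add: op closure_of_subset interior_of_maximal openin_subset)
  have "T closure_of (T interior_of (T closure_of (\<Union>\<R>))) = T closure_of (\<Union>\<R>)"
  proof
    show "T closure_of (T interior_of (T closure_of \<Union> \<R>)) \<subseteq> T closure_of \<Union> \<R>"
      by (metis closure_of_closure_of closure_of_mono interior_of_subset)
    show "T closure_of \<Union> \<R> \<subseteq> T closure_of (T interior_of (T closure_of \<Union> \<R>))"
      using sub by (rule closure_of_mono)
  qed
  then show ?thesis
    by (simp add: regular_join_def)
qed

lemma regular_opens_Int:
  assumes "Q \<in> regular_opens T" "R \<in> regular_opens T"
  shows "Q \<inter> R \<in> regular_opens T"
proof -
  have op: "openin T (Q \<inter> R)"
    using assms by (auto simp: regular_opens_def)
  have "T interior_of (T closure_of (Q \<inter> R)) \<subseteq> T interior_of (T closure_of Q) \<inter> T interior_of (T closure_of R)"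
    by (simp add: closure_of_mono interior_of_mono)
  also have "\<dots> = Q \<inter> R"
    using assms by (auto simp: regular_opens_def)
  finally have "T interior_of (T closure_of (Q \<inter> R)) \<subseteq> Q \<inter> R" .
  moreover have "Q \<inter> R \<subseteq> T interior_of (T closure_of (Q \<inter> R))"
    by (simp add: op closure_of_subset interior_of_maximal openin_subset)
  ultimately show ?thesis
    using op by (auto simp: regular_opens_def)
qed

lemma regular_extension_ex1:
  assumes c: "compactification X Y" and R: "R \<in> regular_opens X"
  shows "\<exists>!Q. Q \<in> regular_opens Y \<and> Q \<inter> topspace X = R"
proof -
  have sub: "topspace X \<subseteq> topspace Y" and dense: "Y closure_of (topspace X) = topspace Y"
    and top: "X = subtopology Y (topspace X)"
    using c by (auto simp: compactification_def)
  have opX: "openin X A \<longleftrightarrow> (\<exists>U. openin Y U \<and> A = U \<inter> topspace X)" for A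
    by (subst top) (auto simp: openin_subtopology)
  have clX: "X closure_of A = topspace X \<inter> Y closure_of A" if "A \<subseteq> topspace X" for A
    by (subst top) (use that in \<open>auto simp: closure_of_subtopology Int_absorb1\<close>)
  have RX: "R \<subseteq> topspace X" "openin X R" and Req: "R = X interior_of (X closure_of R)"
    using R openin_subset by (auto simp: regular_opens_def)
  obtain U where U: "openin Y U" "R = U \<inter> topspace X"
    using RX opX by blast
  have clU: "Y closure_of (U \<inter> topspace X) = Y closure_of U" if "openin Y U" for U
    using that dense openin_subset[OF that] by (simp add: closure_of_openin_Int_superset)
  show ?thesis
  proof (rule ex1I[of _ "Y interior_of (Y closure_of R)"])
    let ?Q = "Y interior_of (Y closure_of R)"
    have "R \<subseteq> ?Q"
      by (metis U clU closure_of_subset inf.coboundedI1 interior_of_maximal_eq openin_subset)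
    moreover have "?Q \<inter> topspace X \<subseteq> R"
    proof -
      have "openin X (?Q \<inter> topspace X)"
        using opX openin_interior_of by blast
      moreover have "?Q \<inter> topspace X \<subseteq> X closure_of R"
        using RX clX interior_of_subset by fastforce
      ultimately show ?thesis
        using Req interior_of_maximal by blast
    qed
    ultimately show "?Q \<in> regular_opens Y \<and> ?Q \<inter> topspace X = R"
      using RX by (auto simp: interior_closure_in_regular_opens)
  next
    fix Q assume "Q \<in> regular_opens Y \<and> Q \<inter> topspace X = R"
    then show "Q = Y interior_of (Y closure_of R)"
      using clU by (auto simp: regular_opens_def)
  qed
qed

section \<open>Contents and integration against a content\<close>

definition content_on :: "'a topology \<Rightarrow> ('a set \<Rightarrow> real) \<Rightarrow> bool" where
  "content_on X \<mu> \<longleftrightarrow>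
     (\<forall>R\<in>regular_opens X. 0 \<le> \<mu> R) \<and>
     (\<forall>\<R>. finite \<R> \<and> \<R> \<subseteq> regular_opens X \<and> disjoint \<R> \<longrightarrow>
        \<mu> (regular_join X \<R>) = (\<Sum>R\<in>\<R>. \<mu> R))"

definition simple_wrt :: "'a topology \<Rightarrow> ('a \<Rightarrow> real) \<Rightarrow> 'a set set \<Rightarrow> ('a set \<Rightarrow> real) \<Rightarrow> bool" where
  "simple_wrt X f \<P> r \<longleftrightarrow> regular_partition X \<P> \<and> (\<forall>P\<in>\<P>. \<forall>x\<in>P. f x = r P)"

definition bounded_simple :: "'a topology \<Rightarrow> ('a \<Rightarrow> real) \<Rightarrow> bool" where
  "bounded_simple X f \<longleftrightarrow> (\<exists>\<P> r. simple_wrt X f \<P> r) \<and> bounded (f ` topspace X)"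

text \<open>The value does not depend on the partition (lemma \<open>simple_integral_eq\<close>).\<close>

definition simple_integral :: "'a topology \<Rightarrow> ('a set \<Rightarrow> real) \<Rightarrow> 'a set \<Rightarrow> ('a \<Rightarrow> real) \<Rightarrow> real" where
  "simple_integral X \<mu> R f =
     (THE s. \<exists>\<P> r. simple_wrt X f \<P> r \<and> s = (\<Sum>P\<in>\<P>. r P * \<mu> (P \<inter> R)))"

definition content_integral :: "'a topology \<Rightarrow> ('a set \<Rightarrow> real) \<Rightarrow> 'a set \<Rightarrow> ('a \<Rightarrow> real) \<Rightarrow> real" where
  "content_integral X \<mu> R g =
     (SUP f \<in> {f. bounded_simple X f \<and> (\<forall>x\<in>R. f x \<le> g x)}. simple_integral X \<mu> R f)"

lemma content_on_empty:
  assumes "content_on X \<mu>"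
  shows "\<mu> {} = 0"
proof -
  have "\<mu> (regular_join X {}) = (\<Sum>R\<in>{}. \<mu> R)"
    using assms unfolding content_on_def by (metis empty_subsetI finite.emptyI pairwise_empty)
  then show ?thesis
    by (simp add: regular_join_def)
qed

lemma content_on_partition:
  assumes \<mu>: "content_on X \<mu>" and P: "regular_partition X \<P>" and A: "A \<in> regular_opens X"
  shows "\<mu> A = (\<Sum>P\<in>\<P>. \<mu> (P \<inter> A))"
proof -
  have fin: "finite \<P>" and reg: "\<P> \<subseteq> regular_opens X" and dis: "disjoint \<P>"
    and join: "regular_join X \<P> = topspace X"
    using P by (auto simp: regular_partition_def)
  have dense: "X closure_of (\<Union>\<P>) = topspace X"
    using join interior_of_subset[of X "X closure_of (\<Union>\<P>)"] closure_of_subset_topspace[of X "\<Union>\<P>"]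
    by (auto simp: regular_join_def)
  have opA: "openin X A" and Aeq: "A = X interior_of (X closure_of A)"
    using A by (auto simp: regular_opens_def)
  let ?\<R> = "(\<lambda>P. P \<inter> A) ` \<P>"
  have U: "\<Union>?\<R> = A \<inter> \<Union>\<P>"
    by auto
  have "X closure_of (A \<inter> \<Union>\<P>) = X closure_of A"
    using opA dense openin_subset[OF opA] by (simp add: closure_of_openin_Int_superset)
  then have "regular_join X ?\<R> = A"
    unfolding regular_join_def U using Aeq by simp
  moreover have "?\<R> \<subseteq> regular_opens X"
    using reg A regular_opens_Int by blast
  moreover have "disjoint ?\<R>"
    using dis unfolding disjoint_def by blast
  ultimately have "\<mu> A = (\<Sum>R\<in>?\<R>. \<mu> R)"
    using \<mu> fin unfolding content_on_def by (metis finite_imageI)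
  also have "\<dots> = (\<Sum>P\<in>\<P>. \<mu> (P \<inter> A))"
  proof (subst sum.reindex_nontrivial[OF fin])
    fix P Q assume "P \<in> \<P>" "Q \<in> \<P>" "P \<noteq> Q" "P \<inter> A = Q \<inter> A"
    then have "P \<inter> A = {}"
      using dis unfolding disjoint_def by blast
    then show "\<mu> (P \<inter> A) = 0"
      using content_on_empty[OF \<mu>] by simp
  qed (simp add: o_def)
  finally show ?thesis .
qed

lemma simple_integral_eq:
  assumes \<mu>: "content_on X \<mu>" and R: "R \<in> regular_opens X" and f: "simple_wrt X f \<P> r"
  shows "simple_integral X \<mu> R f = (\<Sum>P\<in>\<P>. r P * \<mu> (P \<inter> R))"
  unfolding simple_integral_def
proof (rule the_equality)
  show "\<exists>\<P>' r'. simple_wrt X f \<P>' r' \<and>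
          (\<Sum>P\<in>\<P>. r P * \<mu> (P \<inter> R)) = (\<Sum>P\<in>\<P>'. r' P * \<mu> (P \<inter> R))"
    using f by blast
next
  have refine: "(\<Sum>P\<in>\<A>. a P * \<mu> (P \<inter> R)) = (\<Sum>P\<in>\<A>. \<Sum>Q\<in>\<B>. a P * \<mu> (P \<inter> Q \<inter> R))"
    if "simple_wrt X f \<A> a" "simple_wrt X f \<B> b" for \<A> \<B> a b
  proof (rule sum.cong[OF refl])
    fix P assume "P \<in> \<A>"
    then have "P \<inter> R \<in> regular_opens X"
      using that R regular_opens_Int by (auto simp: simple_wrt_def regular_partition_def)
    then have "\<mu> (P \<inter> R) = (\<Sum>Q\<in>\<B>. \<mu> (Q \<inter> (P \<inter> R)))"
      using content_on_partition[OF \<mu>] that by (auto simp: simple_wrt_def)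
    then show "a P * \<mu> (P \<inter> R) = (\<Sum>Q\<in>\<B>. a P * \<mu> (P \<inter> Q \<inter> R))"
      by (simp add: sum_distrib_left Int_ac)
  qed
  fix s assume "\<exists>\<Q> q. simple_wrt X f \<Q> q \<and> s = (\<Sum>Q\<in>\<Q>. q Q * \<mu> (Q \<inter> R))"
  then obtain \<Q> q where Q: "simple_wrt X f \<Q> q" and s: "s = (\<Sum>Q\<in>\<Q>. q Q * \<mu> (Q \<inter> R))"
    by blast
  have "s = (\<Sum>Q\<in>\<Q>. \<Sum>P\<in>\<P>. q Q * \<mu> (Q \<inter> P \<inter> R))"
    unfolding s by (rule refine[OF Q f])
  also have "\<dots> = (\<Sum>Q\<in>\<Q>. \<Sum>P\<in>\<P>. r P * \<mu> (P \<inter> Q \<inter> R))"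
  proof (intro sum.cong refl)
    fix P Q assume PQ: "Q \<in> \<Q>" "P \<in> \<P>"
    show "q Q * \<mu> (Q \<inter> P \<inter> R) = r P * \<mu> (P \<inter> Q \<inter> R)"
    proof (cases "P \<inter> Q = {}")
      case True
      then show ?thesis
        using content_on_empty[OF \<mu>] by (simp add: Int_ac)
    next
      case False
      then obtain x where "x \<in> P" "x \<in> Q" by blast
      then have "q Q = r P"
        using f Q PQ unfolding simple_wrt_def by metis
      then show ?thesis by (simp add: Int_ac)
    qed
  qed
  also have "\<dots> = (\<Sum>P\<in>\<P>. \<Sum>Q\<in>\<Q>. r P * \<mu> (P \<inter> Q \<inter> R))"
    by (rule sum.swap)
  also have "\<dots> = (\<Sum>P\<in>\<P>. r P * \<mu> (P \<inter> R))"
    by (rule refine[OF f Q, symmetric])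
  finally show "s = (\<Sum>P\<in>\<P>. r P * \<mu> (P \<inter> R))" .
qed

section \<open>Normal Borel measures and liminal density structures\<close>

definition borel_of :: "'a topology \<Rightarrow> 'a measure" where
  "borel_of T = sigma (topspace T) {U. openin T U}"

definition normal_borel_measure :: "'a topology \<Rightarrow> 'a measure \<Rightarrow> bool" where
  "normal_borel_measure T \<nu> \<longleftrightarrow>
     sets \<nu> = sets (borel_of T) \<and>
     (\<forall>B\<in>sets \<nu>.
        emeasure \<nu> B = (SUP C \<in> {C. closedin T C \<and> C \<subseteq> B}. emeasure \<nu> C) \<and>
        emeasure \<nu> B = (INF U \<in> {U. openin T U \<and> B \<subseteq> U}. emeasure \<nu> U))"

text \<open>Each \<open>\<phi> R\<close> is a representative of an almost-everywhere class of functions on the boundary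
  of \<open>R\<close>; its values off the boundary are irrelevant, and the indicator function realises the
  extension by zero.\<close>

definition liminal_density_structure ::
    "'a topology \<Rightarrow> 'a measure \<Rightarrow> ('a set \<Rightarrow> 'a \<Rightarrow> real) \<Rightarrow> bool" where
  "liminal_density_structure T \<nu> \<phi> \<longleftrightarrow>
     (\<forall>R\<in>regular_opens T.
        set_integrable \<nu> (T frontier_of R) (\<phi> R) \<and>
        (\<forall>x\<in>T frontier_of R. 0 \<le> \<phi> R x \<and> \<phi> R x \<le> 1)) \<and>
     (\<forall>\<P>. regular_partition T \<P> \<longrightarrow>
        (AE x \<in> (\<Union>R\<in>\<P>. T frontier_of R) in \<nu>.
           (\<Sum>R\<in>\<P>. indicator (T frontier_of R) x * \<phi> R x) = 1))"

definition represents_content ::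
    "'a topology \<Rightarrow> 'a topology \<Rightarrow> ('a set \<Rightarrow> real) \<Rightarrow> 'a measure \<Rightarrow> ('a set \<Rightarrow> 'a \<Rightarrow> real) \<Rightarrow> bool" where
  "represents_content X Y \<mu> \<nu> \<phi> \<longleftrightarrow>
     normal_borel_measure Y \<nu> \<and> liminal_density_structure Y \<nu> \<phi> \<and>
     (\<forall>R\<in>regular_opens X.
        let Q = regular_extension X Y R in
          \<mu> R = measure \<nu> Q + (LINT x:Y frontier_of Q|\<nu>. \<phi> Q x))"

text \<open>Equality of liminal density structures, i.e. equality of the classes they represent.\<close>

definition same_density ::
    "'a topology \<Rightarrow> 'a measure \<Rightarrow> ('a set \<Rightarrow> 'a \<Rightarrow> real) \<Rightarrow> ('a set \<Rightarrow> 'a \<Rightarrow> real) \<Rightarrow> bool" where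
  "same_density T \<nu> \<phi> \<psi> \<longleftrightarrow>
     (\<forall>R\<in>regular_opens T. AE x \<in> T frontier_of R in \<nu>. \<phi> R x = \<psi> R x)"

end

theory Submission
  imports Defs
begin

text \<open>Transport \<open>\<mu>\<close> to a content \<open>m\<close> on the regular open subsets of the compactification \<open>T\<close>.
  Setting \<open>\<nu> U\<close> to the supremum of \<open>m P\<close> over the regular open \<open>P\<close> with closure inside the open set
  \<open>U\<close> and applying Caratheodory gives the unique normal Borel measure with
  \<open>\<nu> P \<le> m P \<le> \<nu> (closure P)\<close>. For regular open \<open>Q\<close> the same construction applied to the content
  \<open>P \<mapsto> m (P \<inter> Q)\<close> gives a measure \<open>\<nu>\<^sub>Q \<le> \<nu>\<close> of total mass \<open>m Q\<close>, and these measures add up to \<open>\<nu>\<close>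
  over regular partitions. As \<open>\<nu>\<^sub>Q\<close> vanishes on the complement of \<open>Q\<close>, its density is \<open>1\<close> on \<open>Q\<close> and
  \<open>0\<close> off the closure of \<open>Q\<close>; the liminal density is what is left of it on the boundary.
  Conversely, any representing pair yields densities that satisfy the sandwich inequalities for
  \<open>P \<mapsto> m (P \<inter> Q)\<close>, which forces uniqueness. The integral formula compares both sides on
  partitions into level sets.\<close>

section \<open>Regular open sets and contents\<close>

text \<open>A regular open set does not see nowhere dense sets, but \<open>\<nu>\<close> may charge
  them: a partition joins to the whole space even when its frontiers carry mass. So \<open>m\<close>
  need not be the restriction of a measure, and only the sandwich
  \<open>\<nu> P \<le> m P \<le> \<nu> (closure P)\<close> survives. It still determines
  \<open>\<nu>\<close>, because in a compact Hausdorff space a regular open set fits, with its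
  closure, between a closed set and an open set around it. How \<open>Q\<close> shares the mass on
  its frontier is invisible in the number \<open>m Q\<close>, but the values
  \<open>m (P \<inter> Q)\<close> for all \<open>P\<close> localise it. The transport is harmless:
  by density, intersecting with the original space is an isomorphism of the Boolean algebras of
  regular open sets. Everything becomes linear once the indicator of \<open>Q\<close> and the
  density on its frontier are merged into one function \<open>H\<close>
  (\<open>full_density\<close>): \<open>m Q\<close> is the integral of \<open>H\<close>, the
  functions \<open>H\<close> of a regular partition sum to 1 almost everywhere, and both formulas of
  the theorem concern integrals of \<open>F * H\<close>.\<close>

lemma regular_opensD:
  assumes "R \<in> regular_opens T"
  shows "openin T R" "R \<subseteq> topspace T" "T interior_of (T closure_of R) = R" "R \<subseteq> T closure_of R"
  using assms by (auto simp: regular_opens_def openin_subset closure_of_subset dest: openin_subset)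

lemma regular_opens_complement:
  assumes "openin T R"
  shows "topspace T - T closure_of R \<in> regular_opens T"
proof -
  have "topspace T - T closure_of R = T interior_of (T closure_of (topspace T - R))"
    using assms by (simp add: closure_of_complement interior_of_complement interior_of_openin)
  then show ?thesis
    using interior_closure_in_regular_opens by metis
qed

lemma regular_opens_Diff_closure:
  assumes "P \<in> regular_opens T" "openin T R"
  shows "P - T closure_of R \<in> regular_opens T"
proof -
  have "P - T closure_of R = P \<inter> (topspace T - T closure_of R)"
    using regular_opensD(2)[OF assms(1)] by blast
  then show ?thesis
    using assms by (simp add: regular_opens_Int regular_opens_complement)
qed

lemma empty_in_regular_opens [simp]: "{} \<in> regular_opens T"
  by (simp add: regular_opens_def)

lemma topspace_in_regular_opens [simp]: "topspace T \<in> regular_opens T"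
  by (simp add: regular_opens_def)

lemma regular_partitionI:
  assumes "finite \<P>" "\<P> \<subseteq> regular_opens T" "disjoint \<P>"
    and meets: "\<And>U. \<lbrakk>openin T U; U \<noteq> {}\<rbrakk> \<Longrightarrow> \<exists>P\<in>\<P>. P \<inter> U \<noteq> {}"
  shows "regular_partition T \<P>"
proof -
  have "T closure_of (\<Union>\<P>) = topspace T"
    unfolding dense_intersects_open using meets by blast
  then show ?thesis
    using assms by (simp add: regular_partition_def regular_join_def)
qed

lemma regular_partition_complement:
  assumes R: "R \<in> regular_opens T"
  shows "regular_partition T {R, topspace T - T closure_of R}"
proof (rule regular_partitionI)
  show "disjoint {R, topspace T - T closure_of R}"
    using regular_opensD(4)[OF R] by (auto simp: disjoint_def)
  show "\<exists>P\<in>{R, topspace T - T closure_of R}. P \<inter> U \<noteq> {}" if U: "openin T U" "U \<noteq> {}" for U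
  proof (cases "R \<inter> U = {}")
    case True
    then have "U \<subseteq> topspace T - T closure_of R"
      using openin_subset[OF U(1)] openin_Int_closure_of_eq_empty[OF U(1), of R] by auto
    then have "(topspace T - T closure_of R) \<inter> U \<noteq> {}"
      using U(2) by (simp add: Int_absorb1)
    then show ?thesis
      by simp
  qed simp
qed (use R regular_opens_complement regular_opensD in auto)

text \<open>Cuts the cell \<open>Q\<close> of \<open>regular_partition_complement\<close> along
  \<open>P\<close>; comparing the two partitions yields \<open>full_density_split\<close>. An open
  set that misses \<open>P\<close> misses its closure, so the union stays dense.\<close>

lemma regular_partition_split:
  assumes P: "P \<in> regular_opens T" and Q: "Q \<in> regular_opens T"
  shows "regular_partition T {Q \<inter> P, Q - T closure_of P, topspace T - T closure_of Q}"
proof (rule regular_partitionI)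
  let ?C = "{Q \<inter> P, Q - T closure_of P, topspace T - T closure_of Q}"
  show "disjoint ?C"
    using regular_opensD(4)[OF P] regular_opensD(4)[OF Q] by (auto simp: disjoint_def)
  show "\<exists>R\<in>?C. R \<inter> U \<noteq> {}" if U: "openin T U" "U \<noteq> {}" for U
  proof (cases "U \<inter> Q = {}")
    case True
    then have "U \<subseteq> topspace T - T closure_of Q"
      using openin_subset[OF U(1)] openin_Int_closure_of_eq_empty[OF U(1), of Q] by auto
    then have "(topspace T - T closure_of Q) \<inter> U \<noteq> {}"
      using U(2) by (simp add: Int_absorb1)
    then show ?thesis
      by simp
  next
    case False
    have "openin T (U \<inter> Q)"
      using U regular_opensD(1)[OF Q] by blast
    then have "(U \<inter> Q) \<inter> T closure_of P = {} \<longleftrightarrow> (U \<inter> Q) \<inter> P = {}"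
      by (rule openin_Int_closure_of_eq_empty)
    then have "(Q \<inter> P) \<inter> U \<noteq> {} \<or> (Q - T closure_of P) \<inter> U \<noteq> {}"
      using False by (cases "U \<inter> Q \<inter> P = {}") auto
    then show ?thesis
      by auto
  qed
  show "?C \<subseteq> regular_opens T"
    using regular_opens_Int[OF Q P] regular_opens_Diff_closure[OF Q regular_opensD(1)[OF P]]
      regular_opens_complement[OF regular_opensD(1)[OF Q]] by simp
qed auto

text \<open>Normality gives an open \<open>V\<close> between \<open>C\<close> and \<open>U\<close>;
  taking the interior of its closure makes it regular without enlarging the closure. Through this
  lemma a content on regular open sets controls closed and open sets.\<close>

lemma regular_separation:
  assumes "compact_space T" "Hausdorff_space T" "closedin T C" "openin T U" "C \<subseteq> U"
  obtains P where "P \<in> regular_opens T" "C \<subseteq> P" "T closure_of P \<subseteq> U"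
proof -
  have "normal_space T"
    using assms(1,2) compact_Hausdorff_or_regular_imp_normal_space by auto
  then obtain V where V: "openin T V" "C \<subseteq> V" "T closure_of V \<subseteq> U"
    using assms(3-5) by (meson normal_space_alt)
  show ?thesis
  proof
    show "T interior_of (T closure_of V) \<in> regular_opens T"
      by (rule interior_closure_in_regular_opens)
    show "C \<subseteq> T interior_of (T closure_of V)"
      using V closure_of_subset[OF openin_subset[OF V(1)]] interior_of_maximal[OF _ V(1)] by blast
    show "T closure_of (T interior_of (T closure_of V)) \<subseteq> U"
      using V by (metis closure_of_closure_of closure_of_mono interior_of_subset order_trans)
  qed
qed

text \<open>Sums over cells are indexed by the sets themselves, so \<open>{A, B}\<close> may have
  one element; disjoint equal sets are empty, and \<open>f {} = 0\<close> rescues this case.\<close>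

lemma sum_two_disjoint:
  fixes f :: "'a set \<Rightarrow> real"
  assumes "f {} = 0" "A \<inter> B = {}"
  shows "(\<Sum>R\<in>{A, B}. f R) = f A + f B"
  using assms by (cases "A = B") auto

lemma content_on_split:
  assumes m: "content_on T m" and P: "P \<in> regular_opens T" and Q: "Q \<in> regular_opens T"
  shows "m P = m (P \<inter> Q) + m (P - T closure_of Q)"
proof -
  let ?N = "topspace T - T closure_of Q"
  have N: "?N \<inter> P = P - T closure_of Q"
    using regular_opensD(2)[OF P] by blast
  have "m P = (\<Sum>A\<in>{Q, ?N}. m (A \<inter> P))"
    by (rule content_on_partition[OF m regular_partition_complement[OF Q] P])
  also have "\<dots> = m (Q \<inter> P) + m (?N \<inter> P)"
    using content_on_empty[OF m] regular_opensD(4)[OF Q] by (intro sum_two_disjoint) auto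
  also have "\<dots> = m (P \<inter> Q) + m (P - T closure_of Q)"
    by (simp only: N Int_commute[of Q P])
  finally show ?thesis .
qed

lemma content_on_nonneg: "\<lbrakk>content_on T m; P \<in> regular_opens T\<rbrakk> \<Longrightarrow> 0 \<le> m P"
  by (auto simp: content_on_def)

lemma content_on_mono:
  assumes m: "content_on T m" and "P \<in> regular_opens T" "Q \<in> regular_opens T" "P \<subseteq> Q"
  shows "m P \<le> m Q"
proof -
  have "Q - T closure_of P \<in> regular_opens T"
    using assms regular_opens_Diff_closure regular_opensD(1) by blast
  then show ?thesis
    using content_on_split[OF m, of Q P] content_on_nonneg[OF m] assms by (simp add: Int_absorb1)
qed

lemma content_on_regular_join:
  assumes "content_on T m" "finite \<P>" "\<P> \<subseteq> regular_opens T" "disjoint \<P>"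
  shows "m (regular_join T \<P>) = (\<Sum>P\<in>\<P>. m P)"
  using assms by (simp add: content_on_def)

lemma content_on_disjoint_join:
  assumes m: "content_on T m" and P: "P \<in> regular_opens T" and Q: "Q \<in> regular_opens T"
    and disj: "P \<inter> Q = {}"
  shows "m (regular_join T {P, Q}) = m P + m Q"
proof (cases "P = Q")
  case True
  then have "P = {}" "Q = {}"
    using disj by auto
  then show ?thesis
    using content_on_empty[OF m] by (simp add: regular_join_def)
next
  case False
  have "disjoint {P, Q}"
    using disj by (auto simp: disjoint_def)
  then show ?thesis
    using content_on_regular_join[OF m, of "{P, Q}"] P Q False by simp
qed

lemma Union_subset_regular_join:
  assumes "\<P> \<subseteq> regular_opens T"
  shows "\<Union>\<P> \<subseteq> regular_join T \<P>"
proof -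
  have "openin T (\<Union>\<P>)"
    using assms regular_opensD(1) by blast
  then show ?thesis
    by (simp add: regular_join_def closure_of_subset interior_of_maximal openin_subset)
qed

lemma closure_of_regular_join:
  assumes "\<P> \<subseteq> regular_opens T"
  shows "T closure_of (regular_join T \<P>) = T closure_of (\<Union>\<P>)"
  using closure_of_mono[OF Union_subset_regular_join[OF assms], of T]
  unfolding regular_join_def
  by (metis closure_of_closure_of closure_of_mono interior_of_subset subset_antisym)

lemma regular_join_in_regular_opens: "regular_join T \<P> \<in> regular_opens T"
  by (simp add: regular_join_def interior_closure_in_regular_opens)

section \<open>The measure of a content\<close>

text \<open>Requiring the closure of \<open>P\<close> inside \<open>U\<close>, not just
  \<open>P\<close>, discards what \<open>m\<close> credits to the frontier and puts a compact set
  inside \<open>U\<close>, on which countable subadditivity rests.\<close>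

definition inner_content :: "'a topology \<Rightarrow> ('a set \<Rightarrow> real) \<Rightarrow> 'a set \<Rightarrow> ennreal" where
  "inner_content T m U = (SUP P\<in>{P \<in> regular_opens T. T closure_of P \<subseteq> U}. ennreal (m P))"

definition outer_content :: "'a topology \<Rightarrow> ('a set \<Rightarrow> real) \<Rightarrow> 'a set \<Rightarrow> ennreal" where
  "outer_content T m A = (INF U\<in>{U. openin T U \<and> A \<subseteq> U}. inner_content T m U)"

text \<open>\<open>measure_of\<close> returns the given set function only where it is countably
  additive on the generated sigma-algebra; \<open>emeasure_content_measure\<close> supplies
  this.\<close>

definition content_measure :: "'a topology \<Rightarrow> ('a set \<Rightarrow> real) \<Rightarrow> 'a measure" where
  "content_measure T m = measure_of (topspace T) {U. openin T U} (outer_content T m)"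

lemma inner_content_upper:
  "\<lbrakk>P \<in> regular_opens T; T closure_of P \<subseteq> U\<rbrakk> \<Longrightarrow> ennreal (m P) \<le> inner_content T m U"
  unfolding inner_content_def by (rule SUP_upper) simp

lemma inner_content_least:
  "(\<And>P. \<lbrakk>P \<in> regular_opens T; T closure_of P \<subseteq> U\<rbrakk> \<Longrightarrow> ennreal (m P) \<le> c) \<Longrightarrow> inner_content T m U \<le> c"
  unfolding inner_content_def by (rule SUP_least) simp

lemma inner_content_mono: "U \<subseteq> V \<Longrightarrow> inner_content T m U \<le> inner_content T m V"
  by (rule inner_content_least) (rule inner_content_upper, auto)

lemma outer_content_lower: "\<lbrakk>openin T U; A \<subseteq> U\<rbrakk> \<Longrightarrow> outer_content T m A \<le> inner_content T m U"
  unfolding outer_content_def by (rule INF_lower) simp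

lemma outer_content_greatest:
  "(\<And>U. \<lbrakk>openin T U; A \<subseteq> U\<rbrakk> \<Longrightarrow> c \<le> inner_content T m U) \<Longrightarrow> c \<le> outer_content T m A"
  unfolding outer_content_def by (rule INF_greatest) simp

lemma outer_content_mono: "A \<subseteq> B \<Longrightarrow> outer_content T m A \<le> outer_content T m B"
  by (rule outer_content_greatest) (rule outer_content_lower, auto)

lemma outer_content_open: "openin T U \<Longrightarrow> outer_content T m U = inner_content T m U"
  by (intro antisym outer_content_lower outer_content_greatest inner_content_mono) auto

lemma space_borel_of [simp]: "space (borel_of T) = topspace T"
  by (simp add: borel_of_def space_measure_of_conv)

lemma sets_borel_of: "sets (borel_of T) = sigma_sets (topspace T) {U. openin T U}"
  unfolding borel_of_def by (rule sets_measure_of) (auto dest: openin_subset)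

lemma openin_in_sets_borel_of: "openin T U \<Longrightarrow> U \<in> sets (borel_of T)"
  by (simp add: sets_borel_of)

lemma closedin_in_sets_borel_of: "closedin T C \<Longrightarrow> C \<in> sets (borel_of T)"
  by (metis closedin_def double_diff openin_in_sets_borel_of sets.compl_sets space_borel_of subset_refl)

lemma sets_content_measure [simp]: "sets (content_measure T m) = sets (borel_of T)"
  unfolding content_measure_def sets_borel_of by (rule sets_measure_of) (auto dest: openin_subset)

lemma space_content_measure [simp]: "space (content_measure T m) = topspace T"
  by (simp add: content_measure_def space_measure_of_conv)

section \<open>The Caratheodory construction from a content on a compact Hausdorff space\<close>

locale regular_content =
  fixes T :: "'a topology" and m :: "'a set \<Rightarrow> real"
  assumes compact: "compact_space T" and Hausdorff: "Hausdorff_space T" and content: "content_on T m"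
begin

lemmas content_split = content_on_split[OF content]
lemmas content_nonneg = content_on_nonneg[OF content]
lemmas content_mono = content_on_mono[OF content]

lemma inner_content_empty: "inner_content T m {} = 0"
proof -
  have "inner_content T m {} \<le> 0"
  proof (rule inner_content_least)
    fix P assume "P \<in> regular_opens T" "T closure_of P \<subseteq> {}"
    then have "P = {}"
      using regular_opensD(4) by auto
    then show "ennreal (m P) \<le> 0"
      using content_on_empty[OF content] by simp
  qed
  then show ?thesis
    by simp
qed

lemma inner_content_le_content:
  assumes "Q \<in> regular_opens T"
  shows "inner_content T m Q \<le> ennreal (m Q)"
proof (rule inner_content_least)
  fix P assume "P \<in> regular_opens T" "T closure_of P \<subseteq> Q"
  then show "ennreal (m P) \<le> ennreal (m Q)"
    using assms regular_opensD(4)[of P] by (intro ennreal_leI content_mono) auto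
qed

text \<open>Cut \<open>P\<close> along a regular \<open>Q\<close> between the closed set
  \<open>T closure_of P - V\<close> and \<open>U\<close>. The part in \<open>Q\<close> has closure
  in \<open>U\<close>; the closure of the rest misses the open set \<open>Q\<close>, hence lies in
  \<open>V\<close>.\<close>

lemma content_le_inner_add:
  assumes P: "P \<in> regular_opens T" and UV: "openin T U" "openin T V" and sub: "T closure_of P \<subseteq> U \<union> V"
  shows "ennreal (m P) \<le> inner_content T m U + inner_content T m V"
proof -
  have "closedin T (T closure_of P - V)"
    using UV by (simp add: closedin_diff)
  then obtain Q where Q: "Q \<in> regular_opens T" "T closure_of P - V \<subseteq> Q" "T closure_of Q \<subseteq> U"
    using regular_separation[OF compact Hausdorff _ UV(1)] sub by (metis Diff_subset_conv sup_commute)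
  let ?R = "P - T closure_of Q"
  have R: "?R \<in> regular_opens T"
    using P Q regular_opens_Diff_closure regular_opensD(1) by blast
  have "Q \<inter> ?R = {}"
    using regular_opensD(4)[OF Q(1)] by auto
  then have "Q \<inter> T closure_of ?R = {}"
    using openin_Int_closure_of_eq_empty[OF regular_opensD(1)[OF Q(1)]] by simp
  moreover have "T closure_of ?R \<subseteq> T closure_of P"
    by (rule closure_of_mono) auto
  ultimately have "T closure_of ?R \<subseteq> V"
    using Q(2) by auto
  moreover have "T closure_of (P \<inter> Q) \<subseteq> U"
    using Q(3) closure_of_mono[of "P \<inter> Q" Q T] by auto
  ultimately have "ennreal (m (P \<inter> Q)) + ennreal (m ?R) \<le> inner_content T m U + inner_content T m V"
    using R P Q by (intro add_mono inner_content_upper regular_opens_Int)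
  then show ?thesis
    using content_split[OF P Q(1)] R P Q content_nonneg
    by (simp add: regular_opens_Int)
qed

lemma inner_content_Un:
  assumes "openin T U" "openin T V"
  shows "inner_content T m (U \<union> V) \<le> inner_content T m U + inner_content T m V"
  using assms by (intro inner_content_least content_le_inner_add)

lemma inner_content_UN_finite:
  fixes U :: "nat \<Rightarrow> 'a set"
  assumes "\<And>i. openin T (U i)"
  shows "inner_content T m (\<Union>i<n. U i) \<le> (\<Sum>i<n. inner_content T m (U i))"
proof (induction n)
  case 0
  then show ?case
    using inner_content_empty by simp
next
  case (Suc n)
  have "inner_content T m (\<Union>i<Suc n. U i) = inner_content T m ((\<Union>i<n. U i) \<union> U n)"
    by (simp add: lessThan_Suc Un_commute)
  also have "\<dots> \<le> inner_content T m (\<Union>i<n. U i) + inner_content T m (U n)"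
    using assms by (intro inner_content_Un) auto
  also have "\<dots> \<le> (\<Sum>i<Suc n. inner_content T m (U i))"
    using Suc.IH by (simp add: add_right_mono)
  finally show ?case .
qed

text \<open>The closure of an admissible \<open>P\<close> is compact, so finitely many
  \<open>U i\<close> cover it and the finite case applies.\<close>

lemma inner_content_UN:
  fixes U :: "nat \<Rightarrow> 'a set"
  assumes U: "\<And>i. openin T (U i)"
  shows "inner_content T m (\<Union>i. U i) \<le> (\<Sum>i. inner_content T m (U i))"
proof (rule inner_content_least)
  fix P assume P: "P \<in> regular_opens T" "T closure_of P \<subseteq> (\<Union>i. U i)"
  have "compactin T (T closure_of P)"
    by (simp add: closedin_compact_space compact)
  then obtain \<F> where \<F>: "finite \<F>" "\<F> \<subseteq> range U" "T closure_of P \<subseteq> \<Union>\<F>"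
    unfolding compactin_def using P(2) U by (metis (mono_tags, lifting) image_iff)
  then obtain I where I: "finite I" "\<F> = U ` I"
    by (meson finite_subset_image)
  then obtain n where "I \<subseteq> {..<n}"
    by (meson finite_nat_iff_bounded)
  then have "\<Union>\<F> \<subseteq> (\<Union>i<n. U i)"
    unfolding I(2) by (intro UN_mono) auto
  then have "T closure_of P \<subseteq> (\<Union>i<n. U i)"
    using \<F>(3) by (rule order_trans[rotated])
  then have "ennreal (m P) \<le> inner_content T m (\<Union>i<n. U i)"
    by (rule inner_content_upper[OF P(1)])
  also have "\<dots> \<le> (\<Sum>i<n. inner_content T m (U i))"
    by (rule inner_content_UN_finite[OF U])
  also have "\<dots> \<le> (\<Sum>i. inner_content T m (U i))"
    by (rule sum_le_suminf) auto
  finally show "ennreal (m P) \<le> (\<Sum>i. inner_content T m (U i))" .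
qed

lemma outer_content_empty: "outer_content T m {} = 0"
  by (simp add: outer_content_open inner_content_empty)

lemma outer_content_finite:
  assumes "A \<subseteq> topspace T"
  shows "outer_content T m A < \<infinity>"
proof -
  have "outer_content T m A \<le> inner_content T m (topspace T)"
    using assms by (simp add: outer_content_lower)
  also have "\<dots> \<le> ennreal (m (topspace T))"
    by (simp add: inner_content_le_content)
  finally show ?thesis
    by (simp add: order_le_less_trans)
qed

lemma countably_subadditive_outer_content:
  "countably_subadditive (Pow (topspace T)) (outer_content T m)"
proof (simp add: countably_subadditive_def, safe)
  fix A :: "nat \<Rightarrow> 'a set" assume A: "range A \<subseteq> Pow (topspace T)"
  let ?O = "outer_content T m"
  show "?O (\<Union>i. A i) \<le> (\<Sum>n. ?O (A n))"
  proof (rule ennreal_le_epsilon)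
    fix e :: real assume e: "0 < e"
    \<comment> \<open>The slacks add up to \<open>e\<close>. As the outer content of
      \<open>A n\<close> is finite, adding the slack strictly enlarges it, so some open superset
      stays below.\<close>
    have "\<exists>U. openin T U \<and> A n \<subseteq> U \<and> inner_content T m U \<le> ?O (A n) + ennreal (e * (1/2)^Suc n)" for n
    proof -
      have fin: "?O (A n) < \<infinity>"
        using A by (intro outer_content_finite) auto
      have "?O (A n) + 0 < ?O (A n) + ennreal (e * (1/2)^Suc n)"
        using e fin by (subst ennreal_add_left_cancel_less) auto
      then show ?thesis
        unfolding outer_content_def[of T m "A n"] add_0_right INF_less_iff
        by (auto intro: less_imp_le)
    qed
    then obtain U where U: "\<And>n. openin T (U n)" "\<And>n. A n \<subseteq> U n"
      and le: "\<And>n. inner_content T m (U n) \<le> ?O (A n) + ennreal (e * (1/2)^Suc n)"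
      by metis
    have "?O (\<Union>i. A i) \<le> inner_content T m (\<Union>i. U i)"
      using U by (intro outer_content_lower) auto
    also have "\<dots> \<le> (\<Sum>n. inner_content T m (U n))"
      by (rule inner_content_UN[OF U(1)])
    also have "\<dots> \<le> (\<Sum>n. ?O (A n) + ennreal (e * (1/2) ^ Suc n))"
      by (intro suminf_le le) auto
    also have "\<dots> = (\<Sum>n. ?O (A n)) + (\<Sum>n. ennreal e * ennreal ((1/2) ^ Suc n))"
      using e by (subst suminf_add[symmetric])
                 (auto simp del: ennreal_suminf_cmult simp add: ennreal_mult[symmetric])
    also have "\<dots> = (\<Sum>n. ?O (A n)) + ennreal e"
      unfolding ennreal_suminf_cmult
      by (subst suminf_ennreal_eq[OF zero_le_power power_half_series]) auto
    finally show "?O (\<Union>i. A i) \<le> (\<Sum>n. ?O (A n)) + ennreal e" .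
  qed
qed

lemma outer_measure_space_outer_content: "outer_measure_space (Pow (topspace T)) (outer_content T m)"
  by (simp add: outer_measure_space_def positive_def increasing_def outer_content_empty
      outer_content_mono countably_subadditive_outer_content)

text \<open>Disjoint regular \<open>P\<close> and \<open>Q\<close> with closures in \<open>W\<close>
  have a join whose closure, the union of the two closures, is still in \<open>W\<close>; additivity
  of \<open>m\<close> then applies to each \<open>Q\<close> under the supremum.\<close>

lemma inner_content_superadditive:
  assumes P: "P \<in> regular_opens T" and W: "openin T W" "T closure_of P \<subseteq> W"
  shows "ennreal (m P) + inner_content T m (W - T closure_of P) \<le> inner_content T m W"
proof -
  let ?I = "{Q \<in> regular_opens T. T closure_of Q \<subseteq> W - T closure_of P}"
  have ne: "?I \<noteq> {}"
    by (rule ex_in_conv[THEN iffD1], rule exI[of _ "{}"]) simp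
  have "ennreal (m P) + inner_content T m (W - T closure_of P) = (SUP Q\<in>?I. ennreal (m P) + ennreal (m Q))"
    unfolding inner_content_def by (rule ennreal_SUP_add_right[OF ne])
  also have "\<dots> \<le> inner_content T m W"
  proof (rule SUP_least)
    fix Q assume "Q \<in> ?I"
    then have Q: "Q \<in> regular_opens T" "T closure_of Q \<subseteq> W - T closure_of P"
      by auto
    have "P \<inter> Q = {}"
      using regular_opensD(4)[OF P] regular_opensD(4)[OF Q(1)] Q(2) by auto
    then have "m P + m Q = m (regular_join T {P, Q})"
      using content_on_disjoint_join[OF content P Q(1)] by simp
    moreover have "T closure_of (regular_join T {P, Q}) \<subseteq> W"
      using P Q W by (subst closure_of_regular_join) auto
    ultimately show "ennreal (m P) + ennreal (m Q) \<le> inner_content T m W"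
      using inner_content_upper[OF regular_join_in_regular_opens, of T "{P, Q}" W m]
        content_nonneg[OF P] content_nonneg[OF Q(1)] by (simp flip: ennreal_plus)
  qed
  finally show ?thesis .
qed

text \<open>For an open \<open>W\<close> around the test set, \<open>W \<inter> U\<close> is
  exhausted by regular \<open>P\<close> with closure inside it, and \<open>W - U\<close> lies in the
  open set \<open>W - T closure_of P\<close>; superadditivity bounds the sum of the two by the value
  at \<open>W\<close>.\<close>

lemma openin_in_lambda_system:
  assumes U: "openin T U"
  shows "U \<in> lambda_system (topspace T) (Pow (topspace T)) (outer_content T m)"
proof -
  interpret sigma_algebra "topspace T" "Pow (topspace T)"
    by (rule sigma_algebra_Pow)
  let ?O = "outer_content T m"
  have sub: "subadditive (Pow (topspace T)) ?O"
    using countably_subadditive_outer_content outer_content_empty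
    by (intro countably_subadditive_subadditive) (auto simp: positive_def)
  have "?O (A \<inter> U) + ?O (A - U) = ?O A" if A: "A \<subseteq> topspace T" for A
  proof (rule antisym)
    have "?O ((A \<inter> U) \<union> (A - U)) \<le> ?O (A \<inter> U) + ?O (A - U)"
      by (rule subadditiveD[OF sub]) (use A in auto)
    then show "?O A \<le> ?O (A \<inter> U) + ?O (A - U)"
      by (simp add: Int_Diff_Un)
    show "?O (A \<inter> U) + ?O (A - U) \<le> ?O A"
    proof (rule outer_content_greatest)
      fix W assume W: "openin T W" "A \<subseteq> W"
      let ?I = "{P \<in> regular_opens T. T closure_of P \<subseteq> W \<inter> U}"
      have "?O (A \<inter> U) + ?O (A - U) \<le> inner_content T m (W \<inter> U) + ?O (W - U)"
        using W U by (intro add_mono outer_content_mono outer_content_lower) auto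
      also have "\<dots> = (SUP P\<in>?I. ennreal (m P) + ?O (W - U))"
        unfolding inner_content_def
        by (rule ennreal_SUP_add_left[symmetric], rule ex_in_conv[THEN iffD1], rule exI[of _ "{}"]) simp
      also have "\<dots> \<le> inner_content T m W"
      proof (rule SUP_least)
        fix P assume "P \<in> ?I"
        then have P: "P \<in> regular_opens T" "T closure_of P \<subseteq> W" "T closure_of P \<subseteq> U"
          by auto
        have "ennreal (m P) + ?O (W - U) \<le> ennreal (m P) + inner_content T m (W - T closure_of P)"
          using W P by (intro add_left_mono outer_content_lower openin_diff) auto
        also have "\<dots> \<le> inner_content T m W"
          by (rule inner_content_superadditive[OF P(1) W(1) P(2)])
        finally show "ennreal (m P) + ?O (W - U) \<le> inner_content T m W" .
      qed
      finally show "?O (A \<inter> U) + ?O (A - U) \<le> inner_content T m W" .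
    qed
  qed
  then show ?thesis
    using openin_subset[OF U] by (simp add: lambda_system_eq)
qed

text \<open>The Caratheodory sigma-algebra contains the open sets, hence all Borel sets, and
  countable additivity is inherited from it.\<close>

lemma emeasure_content_measure:
  assumes "B \<in> sets (borel_of T)"
  shows "emeasure (content_measure T m) B = outer_content T m B"
proof (rule emeasure_measure_of[OF content_measure_def])
  let ?L = "lambda_system (topspace T) (Pow (topspace T)) (outer_content T m)"
  interpret sigma_algebra "topspace T" "Pow (topspace T)"
    by (rule sigma_algebra_Pow)
  have L: "measure_space (topspace T) ?L (outer_content T m)"
    by (rule caratheodory_lemma[OF outer_measure_space_outer_content])
  then interpret L: sigma_algebra "topspace T" ?L
    by (simp add: measure_space_def)
  have "sets (borel_of T) \<subseteq> ?L"
    unfolding sets_borel_of by (rule L.sigma_sets_subset) (auto intro: openin_in_lambda_system)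
  then show "countably_additive (sets (content_measure T m)) (outer_content T m)"
    using L unfolding measure_space_def countably_additive_def sets_content_measure by blast
  show "positive (sets (content_measure T m)) (outer_content T m)"
    by (simp add: positive_def outer_content_empty)
qed (use assms in \<open>auto dest: openin_subset\<close>)

lemma emeasure_content_measure_open:
  "openin T U \<Longrightarrow> emeasure (content_measure T m) U = inner_content T m U"
  by (simp add: emeasure_content_measure openin_in_sets_borel_of outer_content_open)

lemma emeasure_content_measure_le:
  assumes "P \<in> regular_opens T"
  shows "emeasure (content_measure T m) P \<le> ennreal (m P)"
  using assms by (simp add: emeasure_content_measure_open regular_opensD(1) inner_content_le_content)

text \<open>\<open>P\<close> is admissible in the supremum for every open set around its closure.
  Together with \<open>emeasure_content_measure_le\<close> this is the sandwich that characterises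
  the measure.\<close>

lemma content_le_emeasure_closure:
  assumes "P \<in> regular_opens T"
  shows "ennreal (m P) \<le> emeasure (content_measure T m) (T closure_of P)"
  using assms by (simp add: emeasure_content_measure closedin_in_sets_borel_of
      outer_content_greatest inner_content_upper)

lemma emeasure_content_measure_topspace:
  "emeasure (content_measure T m) (topspace T) = ennreal (m (topspace T))"
  using emeasure_content_measure_le[of "topspace T"] content_le_emeasure_closure[of "topspace T"]
  by (simp add: antisym)

lemma finite_measure_content_measure: "finite_measure (content_measure T m)"
  by (rule finite_measureI) (simp add: emeasure_content_measure_topspace)

end

section \<open>Normality, and uniqueness from the sandwich inequalities\<close>

context regular_content
begin

lemma emeasure_content_measure_outer_regular:
  assumes "B \<in> sets (borel_of T)"
  shows "emeasure (content_measure T m) B =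
    (INF U\<in>{U. openin T U \<and> B \<subseteq> U}. emeasure (content_measure T m) U)"
  unfolding emeasure_content_measure[OF assms] outer_content_def
  by (rule INF_cong) (simp_all add: emeasure_content_measure_open)

text \<open>Outer regularity is built into the outer content; inner regularity follows by passing to
  complements, which finite total mass permits.\<close>

lemma normal_borel_measure_content_measure: "normal_borel_measure T (content_measure T m)"
  unfolding normal_borel_measure_def
proof (intro conjI ballI)
  let ?\<nu> = "content_measure T m"
  interpret finite_measure ?\<nu>
    by (rule finite_measure_content_measure)
  fix B assume B: "B \<in> sets ?\<nu>"
  then have Bsub: "B \<subseteq> topspace T"
    using sets.sets_into_space by fastforce
  have D: "topspace T - B \<in> sets ?\<nu>"
    using B by (metis sets.compl_sets space_content_measure)
  show "emeasure ?\<nu> B = (INF U\<in>{U. openin T U \<and> B \<subseteq> U}. emeasure ?\<nu> U)"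
    using B emeasure_content_measure_outer_regular by simp
  show "emeasure ?\<nu> B = (SUP C\<in>{C. closedin T C \<and> C \<subseteq> B}. emeasure ?\<nu> C)"
  proof (rule antisym)
    let ?I = "{U. openin T U \<and> topspace T - B \<subseteq> U}"
    have "emeasure ?\<nu> B = emeasure ?\<nu> (topspace T) - emeasure ?\<nu> (topspace T - B)"
      using emeasure_compl[OF D] Bsub by (simp add: double_diff)
    also have "\<dots> = emeasure ?\<nu> (topspace T) - (INF U\<in>?I. emeasure ?\<nu> U)"
      using D emeasure_content_measure_outer_regular by simp
    also have "\<dots> = (SUP U\<in>?I. emeasure ?\<nu> (topspace T) - emeasure ?\<nu> U)"
      by (rule ennreal_INF_const_minus[symmetric]) (metis (mono_tags, lifting) Diff_subset empty_iff mem_Collect_eq openin_topspace)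
    also have "\<dots> \<le> (SUP C\<in>{C. closedin T C \<and> C \<subseteq> B}. emeasure ?\<nu> C)"
    proof (rule SUP_least)
      fix U assume "U \<in> ?I"
      then have U: "openin T U" "topspace T - B \<subseteq> U"
        by auto
      have "emeasure ?\<nu> (topspace T) - emeasure ?\<nu> U = emeasure ?\<nu> (topspace T - U)"
        using emeasure_compl[of U ?\<nu>] U by (simp add: openin_in_sets_borel_of)
      also have "\<dots> \<le> (SUP C\<in>{C. closedin T C \<and> C \<subseteq> B}. emeasure ?\<nu> C)"
        using U by (intro SUP_upper) auto
      finally show "emeasure ?\<nu> (topspace T) - emeasure ?\<nu> U \<le> (SUP C\<in>{C. closedin T C \<and> C \<subseteq> B}. emeasure ?\<nu> C)" .
    qed
    finally show "emeasure ?\<nu> B \<le> (SUP C\<in>{C. closedin T C \<and> C \<subseteq> B}. emeasure ?\<nu> C)" .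
    show "(SUP C\<in>{C. closedin T C \<and> C \<subseteq> B}. emeasure ?\<nu> C) \<le> emeasure ?\<nu> B"
      using B by (intro SUP_least emeasure_mono) auto
  qed
qed simp

end

lemma borel_of_measure_eqI:
  assumes "sets M = sets (borel_of T)" "sets N = sets (borel_of T)"
    and eq: "\<And>U. openin T U \<Longrightarrow> emeasure M U = emeasure N U"
    and fin: "emeasure M (topspace T) \<noteq> \<infinity>"
  shows "M = N"
proof (rule measure_eqI_generator_eq[where E="{U. openin T U}" and \<Omega>="topspace T" and A="\<lambda>_. topspace T"])
  show "Int_stable {U. openin T U}"
    by (auto simp: Int_stable_def)
qed (use assms in \<open>auto simp: sets_borel_of dest: openin_subset\<close>)

context regular_content
begin

text \<open>A regular \<open>P\<close> around a closed \<open>C\<close>, with closure in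
  \<open>U\<close>, gives \<open>N C \<le> N P \<le> m P \<le> inner_content T m U\<close>; inner
  regularity turns this into one inequality on open sets, and \<open>ge\<close> gives the
  other.\<close>

lemma content_measure_unique:
  assumes sets: "sets N = sets (borel_of T)"
    and inner: "\<And>U. openin T U \<Longrightarrow> emeasure N U = (SUP C\<in>{C. closedin T C \<and> C \<subseteq> U}. emeasure N C)"
    and le: "\<And>P. P \<in> regular_opens T \<Longrightarrow> emeasure N P \<le> ennreal (m P)"
    and ge: "\<And>P. P \<in> regular_opens T \<Longrightarrow> ennreal (m P) \<le> emeasure N (T closure_of P)"
  shows "N = content_measure T m"
proof (rule borel_of_measure_eqI[OF sets])
  show "emeasure N (topspace T) \<noteq> \<infinity>"
    using le[of "topspace T"] by (auto simp: top_unique)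
  fix U assume U: "openin T U"
  have "emeasure N U \<le> inner_content T m U"
    unfolding inner[OF U]
  proof (rule SUP_least)
    fix C assume "C \<in> {C. closedin T C \<and> C \<subseteq> U}"
    then obtain P where P: "P \<in> regular_opens T" "C \<subseteq> P" "T closure_of P \<subseteq> U"
      using regular_separation[OF compact Hausdorff _ U] by blast
    have "emeasure N C \<le> emeasure N P"
      using P sets by (intro emeasure_mono) (auto simp: openin_in_sets_borel_of regular_opensD(1))
    also have "\<dots> \<le> ennreal (m P)"
      by (rule le[OF P(1)])
    also have "\<dots> \<le> inner_content T m U"
      using P by (intro inner_content_upper)
    finally show "emeasure N C \<le> inner_content T m U" .
  qed
  moreover have "inner_content T m U \<le> emeasure N U"
  proof (rule inner_content_least)
    fix P assume P: "P \<in> regular_opens T" "T closure_of P \<subseteq> U"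
    have "ennreal (m P) \<le> emeasure N (T closure_of P)"
      by (rule ge[OF P(1)])
    also have "\<dots> \<le> emeasure N U"
      using P U sets by (intro emeasure_mono) (auto simp: openin_in_sets_borel_of)
    finally show "ennreal (m P) \<le> emeasure N U" .
  qed
  ultimately show "emeasure N U = emeasure (content_measure T m) U"
    using U by (simp add: emeasure_content_measure_open)
qed simp

end

section \<open>Additivity of the construction in the content, and restricted contents\<close>

lemma content_on_add:
  assumes "content_on T m" "content_on T m'"
  shows "content_on T (\<lambda>P. m P + m' P)"
  using assms by (simp add: content_on_def sum.distrib)

lemma content_on_sum:
  assumes "finite I" "\<And>i. i \<in> I \<Longrightarrow> content_on T (m i)"
  shows "content_on T (\<lambda>P. \<Sum>i\<in>I. m i P)"
  using assms
proof (induction I rule: finite_induct)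
  case empty
  then show ?case
    by (simp add: content_on_def)
next
  case (insert i I)
  then show ?case
    using content_on_add[of T "m i" "\<lambda>P. \<Sum>i\<in>I. m i P"] by simp
qed

lemma inner_content_cong:
  assumes "\<And>P. P \<in> regular_opens T \<Longrightarrow> m P = m' P"
  shows "inner_content T m U = inner_content T m' U"
  unfolding inner_content_def using assms by (intro SUP_cong) auto

lemma content_measure_cong:
  assumes "\<And>P. P \<in> regular_opens T \<Longrightarrow> m P = m' P"
  shows "content_measure T m = content_measure T m'"
proof -
  have "inner_content T m = inner_content T m'"
    by (rule ext) (rule inner_content_cong[OF assms])
  then have "outer_content T m = outer_content T m'"
    by (simp add: outer_content_def fun_eq_iff)
  then show ?thesis
    by (simp add: content_measure_def)
qed

text \<open>The supremum of the sum splits because the index set is directed: the join of two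
  admissible sets is admissible and contains both.\<close>

lemma inner_content_add:
  assumes m: "content_on T m" and m': "content_on T m'"
  shows "inner_content T (\<lambda>P. m P + m' P) U = inner_content T m U + inner_content T m' U"
proof -
  let ?I = "{P \<in> regular_opens T. T closure_of P \<subseteq> U}"
  have "inner_content T (\<lambda>P. m P + m' P) U = (SUP P\<in>?I. ennreal (m P) + ennreal (m' P))"
    unfolding inner_content_def
    using content_on_nonneg[OF m] content_on_nonneg[OF m'] by (intro SUP_cong) auto
  also have "\<dots> = inner_content T m U + inner_content T m' U"
    unfolding inner_content_def
  proof (rule SUP_add_directed_ennreal)
    fix P Q assume PQ: "P \<in> ?I" "Q \<in> ?I"
    let ?J = "regular_join T {P, Q}"
    have J: "?J \<in> regular_opens T" "T closure_of ?J = T closure_of P \<union> T closure_of Q"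
      using PQ by (auto simp: regular_join_in_regular_opens closure_of_regular_join)
    have "P \<union> Q \<subseteq> ?J"
      using Union_subset_regular_join[of "{P, Q}" T] PQ by simp
    then have "ennreal (m P) + ennreal (m' Q) \<le> ennreal (m ?J) + ennreal (m' ?J)"
      using PQ J content_on_mono[OF m] content_on_mono[OF m'] by (intro add_mono ennreal_leI) auto
    moreover have "?J \<in> ?I"
      using PQ J by auto
    ultimately show "\<exists>J\<in>?I. ennreal (m P) + ennreal (m' Q) \<le> ennreal (m J) + ennreal (m' J)"
      by blast
  qed
  finally show ?thesis .
qed

lemma inner_content_sum:
  assumes "finite I" "\<And>i. i \<in> I \<Longrightarrow> content_on T (m i)"
  shows "inner_content T (\<lambda>P. \<Sum>i\<in>I. m i P) U = (\<Sum>i\<in>I. inner_content T (m i) U)"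
  using assms
proof (induction I rule: finite_induct)
  case empty
  have "inner_content T (\<lambda>P. 0) U \<le> 0"
    by (rule inner_content_least) simp
  then show ?case
    by simp
next
  case (insert i I)
  then show ?case
    using inner_content_add[OF _ content_on_sum[of I T m], of "m i" U] by simp
qed

text \<open>Distributive law in the Boolean algebra of regular open sets. It rests on
  \<open>Q \<inter> closure A \<subseteq> closure (Q \<inter> A)\<close> for open
  \<open>Q\<close>.\<close>

lemma regular_join_Int:
  assumes "\<P> \<subseteq> regular_opens T" "Q \<in> regular_opens T"
  shows "regular_join T ((\<lambda>P. P \<inter> Q) ` \<P>) = regular_join T \<P> \<inter> Q"
proof
  have U: "\<Union>((\<lambda>P. P \<inter> Q) ` \<P>) = Q \<inter> \<Union>\<P>"
    by auto
  have Q: "openin T Q" "T interior_of (T closure_of Q) = Q"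
    using assms(2) regular_opensD by blast+
  show "regular_join T ((\<lambda>P. P \<inter> Q) ` \<P>) \<subseteq> regular_join T \<P> \<inter> Q"
    unfolding regular_join_def U
    using interior_of_mono[OF closure_of_mono[of "Q \<inter> \<Union>\<P>" "\<Union>\<P>" T], of T]
      interior_of_mono[OF closure_of_mono[of "Q \<inter> \<Union>\<P>" Q T], of T] Q(2) by simp
  have "Q \<inter> regular_join T \<P> \<subseteq> Q \<inter> T closure_of (\<Union>\<P>)"
    unfolding regular_join_def by (intro Int_mono order_refl interior_of_subset)
  also have "\<dots> \<subseteq> T closure_of (Q \<inter> \<Union>\<P>)"
    by (rule openin_Int_closure_of_subset[OF Q(1)])
  finally have "Q \<inter> regular_join T \<P> \<subseteq> T interior_of (T closure_of (Q \<inter> \<Union>\<P>))"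
    by (rule interior_of_maximal) (simp add: Q regular_join_def openin_Int)
  then show "regular_join T \<P> \<inter> Q \<subseteq> regular_join T ((\<lambda>P. P \<inter> Q) ` \<P>)"
    unfolding regular_join_def U by auto
qed

lemma content_on_restrict:
  assumes m: "content_on T m" and Q: "Q \<in> regular_opens T"
  shows "content_on T (\<lambda>P. m (P \<inter> Q))"
  unfolding content_on_def
proof (intro conjI allI impI ballI)
  show "0 \<le> m (R \<inter> Q)" if "R \<in> regular_opens T" for R
    using content_on_nonneg[OF m] regular_opens_Int[OF that Q] by blast
  fix \<P> assume P: "finite \<P> \<and> \<P> \<subseteq> regular_opens T \<and> disjoint \<P>"
  then have disj: "disjoint ((\<lambda>P. P \<inter> Q) ` \<P>)"
    unfolding disjoint_def by blast
  have "m (regular_join T \<P> \<inter> Q) = m (regular_join T ((\<lambda>P. P \<inter> Q) ` \<P>))"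
    using P Q by (simp add: regular_join_Int)
  also have "\<dots> = (\<Sum>R\<in>(\<lambda>P. P \<inter> Q) ` \<P>. m R)"
    using P Q disj by (intro content_on_regular_join[OF m]) (auto intro!: regular_opens_Int)
  also have "\<dots> = (\<Sum>R\<in>\<P>. m (R \<inter> Q))"
  \<comment> \<open>Different cells have equal traces on \<open>Q\<close> only if these are empty,
    and the empty set has content 0.\<close>
  proof (subst sum.reindex_nontrivial)
    fix A B assume "A \<in> \<P>" "B \<in> \<P>" "A \<noteq> B" "A \<inter> Q = B \<inter> Q"
    then have "A \<inter> Q = {}"
      using P unfolding disjoint_def by blast
    then show "m (A \<inter> Q) = 0"
      using content_on_empty[OF m] by simp
  qed (use P in auto)
  finally show "m (regular_join T \<P> \<inter> Q) = (\<Sum>R\<in>\<P>. m (R \<inter> Q))" .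
qed

section \<open>Liminal densities\<close>

definition content_part :: "'a topology \<Rightarrow> ('a set \<Rightarrow> real) \<Rightarrow> 'a set \<Rightarrow> 'a measure" where
  "content_part T m Q = content_measure T (\<lambda>P. m (P \<inter> Q))"

definition content_density :: "'a topology \<Rightarrow> ('a set \<Rightarrow> real) \<Rightarrow> 'a set \<Rightarrow> 'a \<Rightarrow> ennreal" where
  "content_density T m Q = RN_deriv (content_measure T m) (content_part T m Q)"

text \<open>The Radon-Nikodym derivative is at most 1 only almost everywhere; truncation secures the
  bound at every point, as \<open>liminal_density_structure\<close> demands.\<close>

definition liminal_density :: "'a topology \<Rightarrow> ('a set \<Rightarrow> real) \<Rightarrow> 'a set \<Rightarrow> 'a \<Rightarrow> real" where
  "liminal_density T m Q x = enn2real (min 1 (content_density T m Q x))"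

definition full_density :: "'a topology \<Rightarrow> ('a set \<Rightarrow> 'a \<Rightarrow> real) \<Rightarrow> 'a set \<Rightarrow> 'a \<Rightarrow> real" where
  "full_density T \<phi> Q x = indicator Q x + indicator (T frontier_of Q) x * \<phi> Q x"

lemma frontier_of_openin: "openin T Q \<Longrightarrow> T frontier_of Q = T closure_of Q - Q"
  by (simp add: frontier_of_def interior_of_openin)

lemma full_density_in: "\<lbrakk>openin T Q; x \<in> Q\<rbrakk> \<Longrightarrow> full_density T \<phi> Q x = 1"
  by (simp add: full_density_def frontier_of_openin)

lemma full_density_outside: "\<lbrakk>Q \<in> regular_opens T; x \<notin> T closure_of Q\<rbrakk> \<Longrightarrow> full_density T \<phi> Q x = 0"
  using regular_opensD(4)[of Q T] by (auto simp: full_density_def frontier_of_openin regular_opensD(1) indicator_def)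

lemma full_density_empty [simp]: "full_density T \<phi> {} x = 0"
  by (simp add: full_density_def)

lemma full_density_topspace [simp]: "x \<in> topspace T \<Longrightarrow> full_density T \<phi> (topspace T) x = 1"
  by (simp add: full_density_in)

text \<open>A frontier point of one cell lies in no cell: another open cell around it would meet the
  first one. So the indicator parts vanish there.\<close>

lemma sum_full_density_frontier:
  assumes P: "regular_partition T \<P>" and x: "x \<in> (\<Union>R\<in>\<P>. T frontier_of R)"
  shows "(\<Sum>R\<in>\<P>. full_density T \<phi> R x) = (\<Sum>R\<in>\<P>. indicator (T frontier_of R) x * \<phi> R x)"
proof (rule sum.cong[OF refl])
  have reg: "\<P> \<subseteq> regular_opens T" and disj: "disjoint \<P>"
    using P by (auto simp: regular_partition_def)
  obtain R' where R': "R' \<in> \<P>" "x \<in> T frontier_of R'"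
    using x by blast
  fix R assume R: "R \<in> \<P>"
  have op: "openin T R" "openin T R'"
    using reg R R' regular_opensD(1) by auto
  have "x \<notin> R"
  proof
    assume xR: "x \<in> R"
    have "x \<in> T closure_of R'" "x \<notin> R'"
      using R'(2) op by (auto simp: frontier_of_openin)
    then have "R \<inter> R' \<noteq> {}" "R \<noteq> R'"
      using xR openin_Int_closure_of_eq_empty[OF op(1), of R'] by auto
    then show False
      using disj R R' by (auto simp: disjoint_def)
  qed
  then show "full_density T \<phi> R x = indicator (T frontier_of R) x * \<phi> R x"
    by (simp add: full_density_def)
qed

text \<open>The closure of a finite union is the union of the closures, so a point off all frontiers
  lies in some cell, and by disjointness in exactly one.\<close>

lemma sum_full_density_off_frontier:
  assumes P: "regular_partition T \<P>" and x: "x \<in> topspace T" "x \<notin> (\<Union>R\<in>\<P>. T frontier_of R)"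
  shows "(\<Sum>R\<in>\<P>. full_density T \<phi> R x) = 1"
proof -
  have reg: "\<P> \<subseteq> regular_opens T" and disj: "disjoint \<P>" and fin: "finite \<P>"
    and join: "regular_join T \<P> = topspace T"
    using P by (auto simp: regular_partition_def)
  have "x \<in> T closure_of (\<Union>\<P>)"
    using x(1) join interior_of_subset[of T "T closure_of \<Union>\<P>"] by (auto simp: regular_join_def)
  then obtain R where R: "R \<in> \<P>" "x \<in> T closure_of R"
    using fin by (auto simp: closure_of_Union)
  have "openin T R"
    using reg R regular_opensD(1) by auto
  then have xR: "x \<in> R"
    using R x(2) by (auto simp: frontier_of_openin)
  have "full_density T \<phi> R' x = (if R' = R then 1 else 0)" if R': "R' \<in> \<P>" for R'
  proof (cases "R' = R")
    case True
    then show ?thesis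
      using xR \<open>openin T R\<close> by (simp add: full_density_in)
  next
    case False
    then have "x \<notin> R'"
      using disj R R' xR by (auto simp: disjoint_def)
    then show ?thesis
      using x(2) R' False by (simp add: full_density_def)
  qed
  then show ?thesis
    using fin R by simp
qed

lemma sum_three_disjoint:
  assumes "f {} = (0::real)" "A \<inter> B = {}" "A \<inter> C = {}" "B \<inter> C = {}"
  shows "(\<Sum>R\<in>{A, B, C}. f R) = f A + f B + f C"
proof (cases "A = B \<or> A = C \<or> B = C")
  case True
  then show ?thesis
    using assms by (elim disjE) (auto simp: insert_absorb sum.insert_if)
qed auto

section \<open>Radon-Nikodym densities of the restricted contents\<close>

context regular_content
begin

abbreviation "\<nu> \<equiv> content_measure T m"

lemma regular_content_restrict: "Q \<in> regular_opens T \<Longrightarrow> regular_content T (\<lambda>P. m (P \<inter> Q))"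
  using compact Hausdorff content_on_restrict[OF content] by unfold_locales

text \<open>Inherited from \<open>m (P \<inter> Q) \<le> m P\<close>; it supplies the absolute
  continuity behind the densities.\<close>

lemma emeasure_content_part_le:
  assumes Q: "Q \<in> regular_opens T" and B: "B \<in> sets (borel_of T)"
  shows "emeasure (content_part T m Q) B \<le> emeasure \<nu> B"
proof -
  interpret part: regular_content T "\<lambda>P. m (P \<inter> Q)"
    by (rule regular_content_restrict[OF Q])
  have "inner_content T (\<lambda>P. m (P \<inter> Q)) U \<le> inner_content T m U" for U
  proof (rule inner_content_least)
    fix P assume P: "P \<in> regular_opens T" "T closure_of P \<subseteq> U"
    have "ennreal (m (P \<inter> Q)) \<le> ennreal (m P)"
      using P Q by (intro ennreal_leI content_mono regular_opens_Int) auto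
    also have "\<dots> \<le> inner_content T m U"
      using P by (rule inner_content_upper)
    finally show "ennreal (m (P \<inter> Q)) \<le> inner_content T m U" .
  qed
  then show ?thesis
    unfolding content_part_def using B
    by (auto simp: emeasure_content_measure part.emeasure_content_measure
        intro!: outer_content_greatest intro: order_trans[OF outer_content_lower])
qed

lemma sets_content_part [simp]: "sets (content_part T m Q) = sets (borel_of T)"
  by (simp add: content_part_def)

lemma borel_measurable_content_density [measurable]: "content_density T m Q \<in> borel_measurable \<nu>"
  unfolding content_density_def by (rule borel_measurable_RN_deriv)

lemma density_content_density:
  assumes Q: "Q \<in> regular_opens T"
  shows "density \<nu> (content_density T m Q) = content_part T m Q"
proof -
  interpret finite_measure \<nu>
    by (rule finite_measure_content_measure)
  have "absolutely_continuous \<nu> (content_part T m Q)"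
    unfolding absolutely_continuous_def
  proof
    fix B assume "B \<in> null_sets \<nu>"
    then show "B \<in> null_sets (content_part T m Q)"
      using emeasure_content_part_le[OF Q, of B] by (auto simp: null_sets_def)
  qed
  then show ?thesis
    unfolding content_density_def by (intro density_RN_deriv) simp_all
qed

text \<open>Over a regular partition the restricted contents add up to \<open>m\<close>, and
  \<open>inner_content\<close> is additive in the content. So the summed density represents
  \<open>\<nu>\<close> itself, and densities are unique.\<close>

lemma AE_sum_content_density:
  assumes P: "regular_partition T \<P>"
  shows "AE x in \<nu>. (\<Sum>P\<in>\<P>. content_density T m P x) = 1"
proof -
  interpret finite_measure \<nu>
    by (rule finite_measure_content_measure)
  have fin: "finite \<P>" and reg: "\<P> \<subseteq> regular_opens T"
    using P by (auto simp: regular_partition_def)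
  let ?h = "\<lambda>x. \<Sum>P\<in>\<P>. content_density T m P x"
  have "\<nu> = density \<nu> ?h"
  proof (rule borel_of_measure_eqI)
    show "emeasure \<nu> (topspace T) \<noteq> \<infinity>"
      by (simp add: emeasure_content_measure_topspace)
    fix U assume U: "openin T U"
    then have Us [measurable]: "U \<in> sets \<nu>"
      by (simp add: openin_in_sets_borel_of)
    have "emeasure (density \<nu> ?h) U = (\<integral>\<^sup>+x. (\<Sum>P\<in>\<P>. content_density T m P x * indicator U x) \<partial>\<nu>)"
      using Us by (simp add: emeasure_density sum_distrib_right)
    also have "\<dots> = (\<Sum>P\<in>\<P>. \<integral>\<^sup>+x. content_density T m P x * indicator U x \<partial>\<nu>)"
      by (intro nn_integral_sum) measurable
    also have "\<dots> = (\<Sum>P\<in>\<P>. emeasure (content_part T m P) U)"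
      using Us reg by (intro sum.cong refl) (auto simp: emeasure_density simp flip: density_content_density)
    also have "\<dots> = (\<Sum>P\<in>\<P>. inner_content T (\<lambda>A. m (A \<inter> P)) U)"
      unfolding content_part_def using reg U regular_content_restrict
      by (intro sum.cong refl regular_content.emeasure_content_measure_open) auto
    also have "\<dots> = inner_content T (\<lambda>A. \<Sum>P\<in>\<P>. m (A \<inter> P)) U"
      using fin reg content_on_restrict[OF content] by (intro inner_content_sum[symmetric]) auto
    also have "\<dots> = inner_content T m U"
      using content_on_partition[OF content P] by (intro inner_content_cong) (simp add: Int_commute)
    also have "\<dots> = emeasure \<nu> U"
      using U by (simp add: emeasure_content_measure_open)
    finally show "emeasure \<nu> U = emeasure (density \<nu> ?h) U" ..
  qed simp_all
  then have "density \<nu> ?h = density \<nu> (\<lambda>_. 1)"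
    by (simp add: density_1)
  then show ?thesis
    by (subst (asm) density_unique_iff) auto
qed

lemma AE_content_density_complement:
  assumes Q: "Q \<in> regular_opens T"
  shows "AE x in \<nu>. content_density T m Q x + content_density T m (topspace T - T closure_of Q) x = 1"
proof (cases "topspace T = {}")
  case True
  then show ?thesis
    by (intro AE_I2) simp
next
  case False
  let ?N = "topspace T - T closure_of Q"
  \<comment> \<open>If the two cells coincided, the sum over the partition would have a single
    term.\<close>
  have "Q \<noteq> ?N"
  proof
    assume eq: "Q = ?N"
    then have "Q = {}"
      using regular_opensD(4)[OF Q] by blast
    then show False
      using False eq by (metis Diff_empty closure_of_empty)
  qed
  then show ?thesis
    using AE_sum_content_density[OF regular_partition_complement[OF Q]] by simp
qed

lemma content_part_null:
  assumes Q: "Q \<in> regular_opens T" and R: "R \<in> regular_opens T" "Q \<inter> R = {}"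
  shows "AE x in \<nu>. x \<in> R \<longrightarrow> content_density T m Q x = 0"
proof -
  interpret part: regular_content T "\<lambda>P. m (P \<inter> Q)"
    by (rule regular_content_restrict[OF Q])
  have "emeasure (content_part T m Q) R = 0"
    using part.emeasure_content_measure_le[OF R(1)] R(2) content_on_empty[OF content]
    by (simp add: content_part_def Int_commute)
  then have "R \<in> null_sets (density \<nu> (content_density T m Q))"
    using R by (simp add: density_content_density[OF Q] null_sets_def openin_in_sets_borel_of regular_opensD(1))
  then show ?thesis
    by (simp add: null_sets_density_iff)
qed

text \<open>On \<open>Q\<close> the density of the exterior vanishes, which leaves 1 for
  \<open>Q\<close>; on the exterior the roles are exchanged. On the frontier the density is at most
  1 almost everywhere, so neither truncation nor \<open>enn2real\<close> alters it.\<close>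

lemma AE_content_density:
  assumes Q: "Q \<in> regular_opens T"
  shows "AE x in \<nu>. content_density T m Q x = ennreal (full_density T (liminal_density T m) Q x)"
proof -
  let ?N = "topspace T - T closure_of Q"
  have N: "?N \<in> regular_opens T" "?N \<inter> Q = {}" and QN: "Q \<inter> ?N = {}"
    using regular_opens_complement[OF regular_opensD(1)[OF Q]] regular_opensD(4)[OF Q] by auto
  have 1: "AE x in \<nu>. x \<in> Q \<longrightarrow> content_density T m ?N x = 0"
    by (rule content_part_null[OF N(1) Q N(2)])
  have 2: "AE x in \<nu>. x \<in> ?N \<longrightarrow> content_density T m Q x = 0"
    by (rule content_part_null[OF Q N(1) QN])
  show ?thesis
    using AE_content_density_complement[OF Q] 1 2 AE_space
  proof eventually_elim
    case (elim x)
    have op: "openin T Q"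
      by (rule regular_opensD(1)[OF Q])
    have le1: "content_density T m Q x \<le> 1"
      using elim(1) by (metis le_iff_add)
    consider "x \<in> Q" | "x \<in> ?N" | "x \<in> T frontier_of Q"
      using elim(4) op by (auto simp: frontier_of_openin)
    then show ?case
    proof cases
      case 1
      then show ?thesis
        using elim op by (simp add: full_density_in)
    next
      case 2
      then show ?thesis
        using elim Q by (simp add: full_density_outside)
    next
      case 3
      then have "full_density T (liminal_density T m) Q x = enn2real (content_density T m Q x)"
        using op le1 by (simp add: full_density_def liminal_density_def frontier_of_openin min_absorb2)
      then show ?thesis
        using le1 by (simp add: less_top order_le_less_trans[OF le1])
    qed
  qed
qed

lemma borel_measurable_liminal_density [measurable]: "liminal_density T m Q \<in> borel_measurable \<nu>"
  unfolding liminal_density_def by measurable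

lemma liminal_density_bounds: "0 \<le> liminal_density T m Q x" "liminal_density T m Q x \<le> 1"
  unfolding liminal_density_def
  using enn2real_mono[of "min 1 (content_density T m Q x)" 1] by auto

lemma AE_sum_full_density:
  assumes P: "regular_partition T \<P>"
  shows "AE x in \<nu>. (\<Sum>P\<in>\<P>. full_density T (liminal_density T m) P x) = 1"
proof -
  have fin: "finite \<P>" and reg: "\<P> \<subseteq> regular_opens T"
    using P by (auto simp: regular_partition_def)
  have "AE x in \<nu>. \<forall>P\<in>\<P>. content_density T m P x = ennreal (full_density T (liminal_density T m) P x)"
    using fin reg AE_content_density by (intro AE_finite_allI) auto
  with AE_sum_content_density[OF P] show ?thesis
  proof eventually_elim
    case (elim x)
    have nn: "0 \<le> full_density T (liminal_density T m) P x" for P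
      by (simp add: full_density_def liminal_density_bounds)
    have "ennreal (\<Sum>P\<in>\<P>. full_density T (liminal_density T m) P x) = 1"
      using elim nn by (simp flip: sum_ennreal)
    then show ?case
      by simp
  qed
qed

lemma liminal_density_structure_liminal_density:
  "liminal_density_structure T \<nu> (liminal_density T m)"
  unfolding liminal_density_structure_def
proof (intro conjI ballI allI impI)
  interpret finite_measure \<nu>
    by (rule finite_measure_content_measure)
  fix R assume "R \<in> regular_opens T"
  have R: "T frontier_of R \<in> sets \<nu>"
    by (simp add: closedin_in_sets_borel_of closedin_frontier_of)
  show "set_integrable \<nu> (T frontier_of R) (liminal_density T m R)"
    unfolding set_integrable_def
  proof (rule integrable_const_bound[where B=1])
    show "AE x in \<nu>. norm (indicator (T frontier_of R) x *\<^sub>R liminal_density T m R x) \<le> 1"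
      using liminal_density_bounds by (intro AE_I2) (simp add: indicator_def)
    show "(\<lambda>x. indicator (T frontier_of R) x *\<^sub>R liminal_density T m R x) \<in> borel_measurable \<nu>"
      using R by (intro borel_measurable_scaleR borel_measurable_indicator borel_measurable_liminal_density)
  qed
next
  fix \<P> assume P: "regular_partition T \<P>"
  from AE_sum_full_density[OF P]
  show "AE x\<in>(\<Union>R\<in>\<P>. T frontier_of R) in \<nu>.
           (\<Sum>R\<in>\<P>. indicator (T frontier_of R) x * liminal_density T m R x) = 1"
  proof eventually_elim
    case (elim x)
    then show ?case
      using sum_full_density_frontier[OF P, of x "liminal_density T m"] by simp
  qed
qed (rule liminal_density_bounds)+

end

lemma borel_measurable_full_density:
  assumes "liminal_density_structure T N \<phi>" "sets N = sets (borel_of T)" "Q \<in> regular_opens T"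
  shows "full_density T \<phi> Q \<in> borel_measurable N"
proof -
  have "(\<lambda>x. indicator (T frontier_of Q) x * \<phi> Q x) \<in> borel_measurable N"
    using assms unfolding liminal_density_structure_def set_integrable_def by auto
  moreover have "Q \<in> sets N"
    using assms by (simp add: openin_in_sets_borel_of regular_opensD(1))
  ultimately show ?thesis
    unfolding full_density_def by simp
qed

lemma full_density_bounds:
  assumes "liminal_density_structure T N \<phi>" "Q \<in> regular_opens T"
  shows "0 \<le> full_density T \<phi> Q x" "full_density T \<phi> Q x \<le> 1"
  using assms regular_opensD(1)[OF assms(2)]
  unfolding full_density_def liminal_density_structure_def
  by (auto simp: indicator_def frontier_of_openin)

lemma AE_sum_full_density_liminal:
  assumes \<phi>: "liminal_density_structure T N \<phi>" and N: "sets N = sets (borel_of T)"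
    and P: "regular_partition T \<P>"
  shows "AE x in N. (\<Sum>R\<in>\<P>. full_density T \<phi> R x) = 1"
proof -
  have space: "space N = topspace T"
    using sets_eq_imp_space_eq[OF N] by simp
  have "AE x\<in>(\<Union>R\<in>\<P>. T frontier_of R) in N. (\<Sum>R\<in>\<P>. indicator (T frontier_of R) x * \<phi> R x) = 1"
    using \<phi> P by (auto simp: liminal_density_structure_def)
  with AE_space show ?thesis
  proof eventually_elim
    case (elim x)
    show ?case
    proof (cases "x \<in> (\<Union>R\<in>\<P>. T frontier_of R)")
      case True
      then show ?thesis
        using elim sum_full_density_frontier[OF P True] by simp
    next
      case False
      then show ?thesis
        using elim space sum_full_density_off_frontier[OF P] by simp
    qed
  qed
qed

section \<open>Integrals and uniqueness\<close>

lemma continuous_map_borel_measurable: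
  assumes F: "continuous_map T euclideanreal F" and N: "sets N = sets (borel_of T)"
  shows "F \<in> borel_measurable N"
proof (rule borel_measurableI)
  fix S :: "real set" assume "open S"
  then have "openin T {x \<in> topspace T. F x \<in> S}"
    using F by (simp add: continuous_map)
  moreover have "F -` S \<inter> space N = {x \<in> topspace T. F x \<in> S}"
    using sets_eq_imp_space_eq[OF N] by auto
  ultimately show "F -` S \<inter> space N \<in> sets N"
    by (simp add: N openin_in_sets_borel_of)
qed

lemma compact_space_continuous_bounded:
  assumes "compact_space T" "continuous_map T euclideanreal F"
  obtains B where "0 < B" "\<And>x. x \<in> topspace T \<Longrightarrow> \<bar>F x\<bar> < B"
proof -
  have "compactin euclideanreal (F ` topspace T)"
    using assms by (meson compact_space_def image_compactin)
  then have "bounded (F ` topspace T)"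
    by (simp add: compact_imp_bounded)
  then obtain B where "0 < B" "\<forall>y\<in>F ` topspace T. norm y \<le> B"
    by (meson bounded_pos)
  then show ?thesis
    by (intro that[of "B + 1"]) force+
qed

lemma integrable_bounded_mult:
  fixes F g :: "'a \<Rightarrow> real"
  assumes N: "finite_measure N" and "F \<in> borel_measurable N" "g \<in> borel_measurable N"
    and B: "0 \<le> B" "\<And>x. x \<in> space N \<Longrightarrow> \<bar>F x\<bar> \<le> B" and g: "\<And>x. \<bar>g x\<bar> \<le> 1"
  shows "integrable N (\<lambda>x. F x * g x)"
proof (rule finite_measure.integrable_const_bound[OF N, where B=B])
  show "AE x in N. norm (F x * g x) \<le> B"
  proof (rule AE_I2)
    fix x assume "x \<in> space N"
    then have "\<bar>F x\<bar> * \<bar>g x\<bar> \<le> B * 1"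
      using B g by (intro mult_mono) auto
    then show "norm (F x * g x) \<le> B"
      by (simp add: abs_mult)
  qed
qed (use assms in measurable)

text \<open>With \<open>F\<close> constantly 1 this gives the representation of the content, with a
  continuous extension the integral formula.\<close>

lemma integral_mult_full_density:
  assumes N: "finite_measure N" "sets N = sets (borel_of T)"
    and \<phi>: "liminal_density_structure T N \<phi>" and Q: "Q \<in> regular_opens T"
    and F: "F \<in> borel_measurable N" "0 \<le> B" "\<And>x. x \<in> topspace T \<Longrightarrow> \<bar>F x\<bar> \<le> B"
  shows "integrable N (\<lambda>x. F x * full_density T \<phi> Q x)"
    and "(LINT x|N. F x * full_density T \<phi> Q x) =
      (LINT x:Q|N. F x) + (LINT x:T frontier_of Q|N. F x * \<phi> Q x)"
proof -
  have sp: "space N = topspace T"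
    using sets_eq_imp_space_eq[OF N(2)] by simp
  have Qs: "Q \<in> sets N"
    using Q N by (simp add: openin_in_sets_borel_of regular_opensD(1))
  have meas: "(\<lambda>x. indicator (T frontier_of Q) x * \<phi> Q x) \<in> borel_measurable N"
    using \<phi> Q unfolding liminal_density_structure_def set_integrable_def by auto
  have bnd: "\<bar>indicator (T frontier_of Q) x * \<phi> Q x\<bar> \<le> 1" for x
    using \<phi> Q unfolding liminal_density_structure_def by (auto simp: indicator_def)
  have 1: "integrable N (\<lambda>x. F x * indicator Q x)"
    using Qs F sp by (intro integrable_bounded_mult[OF N(1)]) (auto simp: indicator_def)
  have 2: "integrable N (\<lambda>x. F x * (indicator (T frontier_of Q) x * \<phi> Q x))"
    using meas bnd F sp by (intro integrable_bounded_mult[OF N(1)]) auto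
  have eq: "(\<lambda>x. F x * full_density T \<phi> Q x) =
      (\<lambda>x. F x * indicator Q x + F x * (indicator (T frontier_of Q) x * \<phi> Q x))"
    by (simp add: full_density_def algebra_simps)
  show "integrable N (\<lambda>x. F x * full_density T \<phi> Q x)"
    unfolding eq using 1 2 by (rule Bochner_Integration.integrable_add)
  show "(LINT x|N. F x * full_density T \<phi> Q x) =
      (LINT x:Q|N. F x) + (LINT x:T frontier_of Q|N. F x * \<phi> Q x)"
    unfolding eq Bochner_Integration.integral_add[OF 1 2] set_lebesgue_integral_def
    by (simp add: mult_ac)
qed

section \<open>Integration against the restricted measures\<close>

context regular_content
begin

lemma content_part_eq_density:
  assumes Q: "Q \<in> regular_opens T"
  shows "content_part T m Q = density \<nu> (\<lambda>x. ennreal (full_density T (liminal_density T m) Q x))"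
proof -
  have [measurable]: "full_density T (liminal_density T m) Q \<in> borel_measurable \<nu>"
    using borel_measurable_full_density[OF liminal_density_structure_liminal_density _ Q] by simp
  show ?thesis
    unfolding density_content_density[OF Q, symmetric]
    by (rule density_cong) (use AE_content_density[OF Q] in auto)
qed

lemma finite_measure_content_part:
  "Q \<in> regular_opens T \<Longrightarrow> finite_measure (content_part T m Q)"
  unfolding content_part_def by (rule regular_content.finite_measure_content_measure[OF regular_content_restrict])

lemma measure_content_part:
  assumes Q: "Q \<in> regular_opens T"
  shows "measure (content_part T m Q) (topspace T) = m Q"
  using regular_content.emeasure_content_measure_topspace[OF regular_content_restrict[OF Q]]
    regular_opensD(2)[OF Q] content_nonneg[OF Q]
  by (simp add: content_part_def measure_def Int_absorb1)

lemma integral_content_part: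
  assumes Q: "Q \<in> regular_opens T" and F: "F \<in> borel_measurable \<nu>"
  shows "(LINT x|content_part T m Q. F x) = (LINT x|\<nu>. F x * full_density T (liminal_density T m) Q x)"
proof -
  note L = liminal_density_structure_liminal_density
  have [measurable]: "full_density T (liminal_density T m) Q \<in> borel_measurable \<nu>"
    using borel_measurable_full_density[OF L _ Q] by simp
  show ?thesis
    unfolding content_part_eq_density[OF Q] using F full_density_bounds[OF L Q]
    by (subst integral_density) (auto simp: mult.commute)
qed

lemma content_representation:
  assumes Q: "Q \<in> regular_opens T"
  shows "m Q = measure \<nu> Q + (LINT x:T frontier_of Q|\<nu>. liminal_density T m Q x)"
proof -
  have Qs: "Q \<in> sets \<nu>" "Q \<inter> topspace T = Q"
    using regular_opensD(1,2)[OF Q] by (auto simp: openin_in_sets_borel_of)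
  have "m Q = (LINT x|content_part T m Q. 1)"
    using measure_content_part[OF Q] sets_eq_imp_space_eq[OF sets_content_part] by simp
  also have "\<dots> = (LINT x|\<nu>. 1 * full_density T (liminal_density T m) Q x)"
    by (rule integral_content_part[OF Q]) simp
  also have "\<dots> = (LINT x:Q|\<nu>. 1) + (LINT x:T frontier_of Q|\<nu>. 1 * liminal_density T m Q x)"
    by (rule integral_mult_full_density(2)[OF finite_measure_content_measure _
          liminal_density_structure_liminal_density Q, where B=1]) auto
  finally show ?thesis
    using Qs by (simp add: set_lebesgue_integral_def)
qed

lemma integral_content_part_partition:
  assumes P: "regular_partition T \<P>" and F: "continuous_map T euclideanreal F"
  shows "(LINT x|\<nu>. F x) = (\<Sum>P\<in>\<P>. LINT x|content_part T m P. F x)"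
proof -
  note L = liminal_density_structure_liminal_density
  have reg: "\<P> \<subseteq> regular_opens T"
    using P by (auto simp: regular_partition_def)
  obtain B where B: "0 < B" "\<And>x. x \<in> topspace T \<Longrightarrow> \<bar>F x\<bar> < B"
    using compact_space_continuous_bounded[OF compact F] by blast
  have Fm: "F \<in> borel_measurable \<nu>"
    using continuous_map_borel_measurable[OF F] by simp
  let ?H = "full_density T (liminal_density T m)"
  have int: "integrable \<nu> (\<lambda>x. F x * ?H P x)" if "P \<in> \<P>" for P
    using that reg B(1)
    by (intro integral_mult_full_density(1)[OF finite_measure_content_measure _ L _ Fm, where B=B])
       (auto intro: less_imp_le[OF B(2)])
  have "(\<Sum>P\<in>\<P>. LINT x|content_part T m P. F x) = (\<Sum>P\<in>\<P>. LINT x|\<nu>. F x * ?H P x)"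
    using reg Fm by (intro sum.cong integral_content_part) auto
  also have "\<dots> = (LINT x|\<nu>. (\<Sum>P\<in>\<P>. F x * ?H P x))"
    using int by (rule Bochner_Integration.integral_sum[symmetric])
  also have "\<dots> = (LINT x|\<nu>. F x)"
  proof (rule integral_cong_AE)
    show "(\<lambda>x. \<Sum>P\<in>\<P>. F x * ?H P x) \<in> borel_measurable \<nu>"
      using int by (intro borel_measurable_sum) (auto dest: borel_measurable_integrable)
    show "AE x in \<nu>. (\<Sum>P\<in>\<P>. F x * ?H P x) = F x"
      using AE_sum_full_density[OF P] by eventually_elim (simp flip: sum_distrib_left)
  qed (rule Fm)
  finally show ?thesis ..
qed

lemma content_part_restrict: "content_part T (\<lambda>P. m (P \<inter> Q)) P = content_part T m (P \<inter> Q)"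
  by (simp add: content_part_def Int_assoc)

text \<open>The partition identity for the content restricted to \<open>Q\<close>; restricting twice
  amounts to restricting to the intersection.\<close>

lemma integral_content_part_split:
  assumes P: "regular_partition T \<P>" and F: "continuous_map T euclideanreal F" and Q: "Q \<in> regular_opens T"
  shows "(LINT x|content_part T m Q. F x) = (\<Sum>P\<in>\<P>. LINT x|content_part T m (P \<inter> Q). F x)"
  using regular_content.integral_content_part_partition[OF regular_content_restrict[OF Q] P F]
  by (simp add: content_part_restrict flip: content_part_def)

lemma AE_content_part_closure:
  assumes Q: "Q \<in> regular_opens T"
  shows "AE x in content_part T m Q. x \<in> T closure_of Q"
proof -
  have meas: "(\<lambda>x. ennreal (full_density T (liminal_density T m) Q x)) \<in> borel_measurable \<nu>"
    using borel_measurable_full_density[OF liminal_density_structure_liminal_density _ Q] by simp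
  show ?thesis
    unfolding content_part_eq_density[OF Q] AE_density[OF meas]
  proof (intro AE_I2 impI)
    fix x assume pos: "0 < ennreal (full_density T (liminal_density T m) Q x)"
    show "x \<in> T closure_of Q"
    proof (rule ccontr)
      assume "x \<notin> T closure_of Q"
      from full_density_outside[OF Q this] pos show False
        by simp
    qed
  qed
qed

lemma integrable_content_part:
  assumes Q: "Q \<in> regular_opens T" and F: "continuous_map T euclideanreal F"
  shows "integrable (content_part T m Q) F"
proof -
  obtain B where B: "0 < B" "\<And>x. x \<in> topspace T \<Longrightarrow> \<bar>F x\<bar> < B"
    using compact_space_continuous_bounded[OF compact F] by blast
  have "space (content_part T m Q) = topspace T"
    by (simp add: content_part_def)
  then show ?thesis
    using B continuous_map_borel_measurable[OF F sets_content_part]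
    by (intro finite_measure.integrable_const_bound[OF finite_measure_content_part[OF Q], where B=B] AE_I2)
       (auto intro: less_imp_le)
qed

text \<open>The bound is asked only on a set \<open>S\<close> whose closure contains
  \<open>Q\<close>, later a set inside the dense subspace. Continuity extends it to the closure of
  \<open>Q\<close>, where the measure is concentrated.\<close>

lemma integral_content_part_ge:
  assumes Q: "Q \<in> regular_opens T" and F: "continuous_map T euclideanreal F"
    and S: "Q \<subseteq> T closure_of S" and c: "\<And>x. x \<in> S \<Longrightarrow> c \<le> F x" and ST: "S \<subseteq> topspace T"
  shows "c * m Q \<le> (LINT x|content_part T m Q. F x)"
proof -
  interpret finite_measure "content_part T m Q"
    by (rule finite_measure_content_part[OF Q])
  have sp: "space (content_part T m Q) = topspace T"
    by (simp add: content_part_def)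
  have "closedin T {x \<in> topspace T. F x \<in> {c..}}"
    using F by (intro closedin_continuous_map_preimage) auto
  moreover have "S \<subseteq> {x \<in> topspace T. F x \<in> {c..}}"
    using c ST by auto
  ultimately have "T closure_of S \<subseteq> {x \<in> topspace T. F x \<in> {c..}}"
    by (intro closure_of_minimal)
  moreover have "T closure_of Q \<subseteq> T closure_of S"
    using S by (intro closure_of_minimal) auto
  ultimately have ge: "c \<le> F x" if "x \<in> T closure_of Q" for x
    using that by auto
  have "c * m Q = (LINT x|content_part T m Q. c)"
    using measure_content_part[OF Q] sp by simp
  also have "\<dots> \<le> (LINT x|content_part T m Q. F x)"
    using AE_content_part_closure[OF Q]
    by (intro integral_mono_AE integrable_content_part[OF Q F]) (auto elim!: eventually_mono ge)
  finally show ?thesis .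
qed

lemma integral_content_part_le:
  assumes Q: "Q \<in> regular_opens T" and F: "continuous_map T euclideanreal F"
    and c: "\<And>x. x \<in> Q \<Longrightarrow> F x \<le> c"
  shows "(LINT x|content_part T m Q. F x) \<le> c * m Q"
proof -
  have "- c * m Q \<le> (LINT x|content_part T m Q. - F x)"
    using F c regular_opensD(2,4)[OF Q]
    by (intro integral_content_part_ge[OF Q, where S=Q]) (auto intro: continuous_map_minus)
  then show ?thesis
    by simp
qed

text \<open>The partition of \<open>Q\<close> and its exterior and the refinement that cuts
  \<open>Q\<close> along \<open>P\<close> both have density sum 1 almost everywhere; the term of the
  exterior cancels.\<close>

lemma full_density_split:
  assumes \<phi>: "liminal_density_structure T N \<phi>" and N: "sets N = sets (borel_of T)"
    and P: "P \<in> regular_opens T" and Q: "Q \<in> regular_opens T"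
  shows "AE x in N. full_density T \<phi> Q x =
    full_density T \<phi> (Q \<inter> P) x + full_density T \<phi> (Q - T closure_of P) x"
proof -
  let ?C = "topspace T - T closure_of Q"
  have disj: "Q \<inter> P \<inter> (Q - T closure_of P) = {}" "Q \<inter> P \<inter> ?C = {}" "(Q - T closure_of P) \<inter> ?C = {}" "Q \<inter> ?C = {}"
    using regular_opensD(4)[OF P] regular_opensD(4)[OF Q] by auto
  show ?thesis
    using AE_sum_full_density_liminal[OF \<phi> N regular_partition_split[OF P Q]]
      AE_sum_full_density_liminal[OF \<phi> N regular_partition_complement[OF Q]]
  proof eventually_elim
    case (elim x)
    then show ?case
      using sum_three_disjoint[of "\<lambda>R. full_density T \<phi> R x", OF full_density_empty disj(1-3)]
        sum_two_disjoint[of "\<lambda>R. full_density T \<phi> R x", OF full_density_empty disj(4)] by simp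
  qed
qed

text \<open>The measure on the left satisfies the sandwich bounds for
  \<open>P \<mapsto> m (P \<inter> Q)\<close> and is inner regular on open sets, so
  \<open>content_measure_unique\<close> identifies it.\<close>

lemma density_full_density_unique:
  assumes N: "normal_borel_measure T N" "finite_measure N" and \<phi>: "liminal_density_structure T N \<phi>"
    and rep: "\<And>Q. Q \<in> regular_opens T \<Longrightarrow> m Q = measure N Q + (LINT x:T frontier_of Q|N. \<phi> Q x)"
    and Q: "Q \<in> regular_opens T"
  shows "density N (\<lambda>x. ennreal (full_density T \<phi> Q x)) = content_part T m Q"
proof -
  let ?H = "full_density T \<phi>"
  interpret N: finite_measure N by (rule N(2))
  have sets: "sets N = sets (borel_of T)"
    using N by (simp add: normal_borel_measure_def)
  note H_bounds = full_density_bounds[OF \<phi>]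
  have H_meas [measurable]: "?H A \<in> borel_measurable N" if "A \<in> regular_opens T" for A
    by (rule borel_measurable_full_density[OF \<phi> sets that])
  have int: "ennreal (m A) = (\<integral>\<^sup>+x. ennreal (?H A x) \<partial>N)" if A: "A \<in> regular_opens T" for A
  proof -
    have As: "A \<in> sets N" "A \<inter> space N = A"
      using A sets sets_eq_imp_space_eq[OF sets] regular_opensD(1,2)[OF A]
      by (auto simp: openin_in_sets_borel_of)
    have "(LINT x|N. 1 * ?H A x) = (LINT x:A|N. 1) + (LINT x:T frontier_of A|N. 1 * \<phi> A x)"
      by (rule integral_mult_full_density(2)[OF N(2) sets \<phi> A, where B=1]) auto
    then have "m A = (LINT x|N. ?H A x)"
      using As rep[OF A] by (simp add: set_lebesgue_integral_def)
    moreover have "integrable N (\<lambda>x. 1 * ?H A x)"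
      by (rule integral_mult_full_density(1)[OF N(2) sets \<phi> A, where B=1]) auto
    ultimately show ?thesis
      using H_bounds[OF A] by (subst nn_integral_eq_integral) auto
  qed
  interpret part: regular_content T "\<lambda>P. m (P \<inter> Q)"
    by (rule regular_content_restrict[OF Q])
  let ?D = "density N (\<lambda>x. ennreal (?H Q x))"
  have D: "emeasure ?D A = (\<integral>\<^sup>+x. ennreal (?H Q x) * indicator A x \<partial>N)" if "A \<in> sets N" for A
    using that H_meas[OF Q] by (intro emeasure_density) auto
  have D_le: "emeasure ?D A \<le> emeasure N A" if A: "A \<in> sets N" for A
  proof -
    have "emeasure ?D A \<le> (\<integral>\<^sup>+x. indicator A x \<partial>N)"
      unfolding D[OF A] using H_bounds[OF Q]
      by (intro nn_integral_mono) (auto simp: indicator_def)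
    then show ?thesis
      using A by simp
  qed
  show ?thesis
    unfolding content_part_def
  proof (rule part.content_measure_unique)
    show "sets ?D = sets (borel_of T)"
      by (simp add: sets)
  next
    fix P assume P: "P \<in> regular_opens T"
    have QP: "Q \<inter> P \<in> regular_opens T" "Q - T closure_of P \<in> regular_opens T"
      using regular_opens_Int[OF Q P] regular_opens_Diff_closure[OF Q regular_opensD(1)[OF P]] by auto
    have Ps: "P \<in> sets N" "T closure_of P \<in> sets N"
      using P sets by (auto simp: openin_in_sets_borel_of closedin_in_sets_borel_of regular_opensD(1))
    \<comment> \<open>On \<open>P\<close> the summand of \<open>Q - T closure_of P\<close> vanishes,
      so \<open>?H Q\<close> and \<open>?H (Q \<inter> P)\<close> agree there almost
      everywhere.\<close>
    have "P \<inter> (Q - T closure_of P) = {}"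
      using regular_opensD(4)[OF P] by auto
    then have disj: "P \<inter> T closure_of (Q - T closure_of P) = {}"
      using openin_Int_closure_of_eq_empty[OF regular_opensD(1)[OF P]] by simp
    have "emeasure ?D P \<le> (\<integral>\<^sup>+x. ennreal (?H (Q \<inter> P) x) \<partial>N)"
      unfolding D[OF Ps(1)]
    proof (rule nn_integral_mono_AE)
      show "AE x in N. ennreal (?H Q x) * indicator P x \<le> ennreal (?H (Q \<inter> P) x)"
        using full_density_split[OF \<phi> sets P Q]
      proof eventually_elim
        case (elim x)
        show ?case
        proof (cases "x \<in> P")
          case True
          then have "x \<notin> T closure_of (Q - T closure_of P)"
            using disj by blast
          from full_density_outside[OF QP(2) this] elim show ?thesis
            by (simp add: True)
        qed simp
      qed
    qed
    then show "emeasure ?D P \<le> ennreal (m (P \<inter> Q))"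
      unfolding int[OF QP(1), symmetric] by (simp add: Int_commute)
    have "ennreal (m (Q \<inter> P)) \<le> emeasure ?D (T closure_of P)"
      unfolding D[OF Ps(2)] int[OF QP(1)]
    proof (rule nn_integral_mono_AE)
      show "AE x in N. ennreal (?H (Q \<inter> P) x) \<le> ennreal (?H Q x) * indicator (T closure_of P) x"
        using full_density_split[OF \<phi> sets P Q]
      proof eventually_elim
        case (elim x)
        show ?case
        proof (cases "x \<in> T closure_of P")
          case True
          then show ?thesis
            using elim H_bounds[OF QP(2)] by (simp add: ennreal_leI)
        next
          case False
          then have "x \<notin> T closure_of (Q \<inter> P)"
            using closure_of_mono[of "Q \<inter> P" P T] by auto
          from full_density_outside[OF QP(1) this] show ?thesis
            by simp
        qed
      qed
    qed
    then show "ennreal (m (P \<inter> Q)) \<le> emeasure ?D (T closure_of P)"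
      by (simp add: Int_commute)
  next
    fix U assume U: "openin T U"
    let ?I = "{C. closedin T C \<and> C \<subseteq> U}"
    have Us: "U \<in> sets N"
      using U sets by (simp add: openin_in_sets_borel_of)
    \<comment> \<open>Inner regularity passes from \<open>N\<close> to \<open>?D\<close>: a closed
      \<open>C\<close> whose complement in \<open>U\<close> has \<open>N\<close>-mass at most
      \<open>e\<close> leaves at most \<open>e\<close> for \<open>?D\<close> too, by
      \<open>D_le\<close>.\<close>
    show "emeasure ?D U = (SUP C\<in>?I. emeasure ?D C)"
    proof (rule antisym)
      show "(SUP C\<in>?I. emeasure ?D C) \<le> emeasure ?D U"
        using Us by (intro SUP_least emeasure_mono) auto
      show "emeasure ?D U \<le> (SUP C\<in>?I. emeasure ?D C)"
      proof (rule ennreal_le_epsilon)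
        fix e :: real assume e: "0 < e"
        have sup: "emeasure N U = (SUP C\<in>?I. emeasure N C)"
          using N(1) Us by (simp add: normal_borel_measure_def)
        have "?I \<noteq> {}"
          by (rule ex_in_conv[THEN iffD1], rule exI[of _ "{}"]) simp
        from SUP_approx_ennreal[OF e this sup]
        obtain C where C: "closedin T C" "C \<subseteq> U" "emeasure N U < emeasure N C + ennreal e"
          by auto
        have Cs: "C \<in> sets N"
          using C sets by (simp add: closedin_in_sets_borel_of)
        have "emeasure N (U - C) = emeasure N U - emeasure N C"
          using C Cs Us by (intro emeasure_Diff) auto
        also have "\<dots> \<le> ennreal e"
          using C by (metis ennreal_minus_le_iff less_imp_le N.emeasure_finite)
        finally have small: "emeasure N (U - C) \<le> ennreal e" .
        have "emeasure ?D U = emeasure ?D C + emeasure ?D (U - C)"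
          using C Cs Us by (subst plus_emeasure) (auto simp: Un_absorb1)
        also have "\<dots> \<le> (SUP C\<in>?I. emeasure ?D C) + ennreal e"
          using C Cs Us small by (intro add_mono SUP_upper order_trans[OF D_le]) auto
        finally show "emeasure ?D U \<le> (SUP C\<in>?I. emeasure ?D C) + ennreal e" .
      qed
    qed
  qed
qed

lemma normal_representation_unique:
  assumes N: "normal_borel_measure T N" "finite_measure N" and \<phi>: "liminal_density_structure T N \<phi>"
    and rep: "\<And>Q. Q \<in> regular_opens T \<Longrightarrow> m Q = measure N Q + (LINT x:T frontier_of Q|N. \<phi> Q x)"
  shows "N = \<nu>" "same_density T \<nu> \<phi> (liminal_density T m)"
proof -
  have sets: "sets N = sets (borel_of T)"
    using N by (simp add: normal_borel_measure_def)
  \<comment> \<open>For the whole space the full density is 1, so the density measure is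
    \<open>N\<close> itself; this settles the measure before the densities are compared.\<close>
  have "density N (\<lambda>x. ennreal (full_density T \<phi> (topspace T) x)) = density N (\<lambda>_. 1)"
    using borel_measurable_full_density[OF \<phi> sets, of "topspace T"] sets_eq_imp_space_eq[OF sets]
    by (intro density_cong) auto
  moreover have "content_part T m (topspace T) = \<nu>"
    unfolding content_part_def
    by (rule content_measure_cong) (simp add: Int_absorb2 regular_opensD(2))
  ultimately show N\<nu>: "N = \<nu>"
    using density_full_density_unique[OF N \<phi> rep, of "topspace T"] by (simp add: density_1)
  show "same_density T \<nu> \<phi> (liminal_density T m)"
    unfolding same_density_def
  proof
    fix R assume R: "R \<in> regular_opens T"
    note L = liminal_density_structure_liminal_density
    have \<phi>': "liminal_density_structure T \<nu> \<phi>"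
      using \<phi> N\<nu> by simp
    interpret finite_measure \<nu>
      by (rule finite_measure_content_measure)
    have "density \<nu> (\<lambda>x. ennreal (full_density T \<phi> R x)) =
        density \<nu> (\<lambda>x. ennreal (full_density T (liminal_density T m) R x))"
      using density_full_density_unique[OF N \<phi> rep R] content_part_eq_density[OF R] N\<nu> by simp
    then have "AE x in \<nu>. ennreal (full_density T \<phi> R x) = ennreal (full_density T (liminal_density T m) R x)"
      using borel_measurable_full_density[OF \<phi>' _ R] borel_measurable_full_density[OF L _ R]
      by (subst (asm) density_unique_iff) auto
    then show "AE x\<in>T frontier_of R in \<nu>. \<phi> R x = liminal_density T m R x"
    proof eventually_elim
      case (elim x)
      then have "full_density T \<phi> R x = full_density T (liminal_density T m) R x"
        using full_density_bounds[OF \<phi>' R] full_density_bounds[OF L R] by simp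
      then show ?case
        by (auto simp: full_density_def frontier_of_openin[OF regular_opensD(1)[OF R]])
    qed
  qed
qed

end

section \<open>Transfer to the compactification\<close>

text \<open>The cells are differences of consecutive regularised sublevel sets \<open>A k\<close>.
  Continuity keeps \<open>F \<le> t k\<close> on \<open>A k\<close>, and \<open>t k \<le> F\<close>
  off it because \<open>L k \<subseteq> A k\<close>.\<close>

lemma level_set_regular_partition:
  assumes T: "compact_space T" and F: "continuous_map T euclideanreal F" and e: "0 < e"
  shows "\<exists>\<P>. regular_partition T \<P> \<and> (\<forall>P\<in>\<P>. \<exists>c. \<forall>x\<in>P. c \<le> F x \<and> F x \<le> c + e)"
proof -
  obtain B where B: "0 < B" "\<And>x. x \<in> topspace T \<Longrightarrow> \<bar>F x\<bar> < B"
    using compact_space_continuous_bounded[OF T F] by blast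
  \<comment> \<open>Levels of step \<open>e\<close> from the lower bound \<open>- B\<close>; the
    choice of \<open>N\<close> puts \<open>t N\<close> above \<open>B\<close>, so that
    \<open>A 0\<close> is empty and \<open>A N\<close> is the whole space.\<close>
  define t where "t k = - B + real k * e" for k
  define L where "L k = {x \<in> topspace T. F x < t k}" for k
  define A where "A k = T interior_of (T closure_of (L k))" for k
  obtain N :: nat where N: "2 * B / e < real N"
    using reals_Archimedean2 by blast
  have A_reg: "A k \<in> regular_opens T" for k
    unfolding A_def by (rule interior_closure_in_regular_opens)
  have "openin T {x \<in> topspace T. F x \<in> {..<t k}}" for k
    using F by (intro openin_continuous_map_preimage) auto
  then have L_open: "openin T (L k)" for k
    by (simp add: L_def)
  have L_A: "L k \<subseteq> A k" for k
    unfolding A_def using L_open by (intro interior_of_maximal closure_of_subset openin_subset)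
  have mono: "A j \<subseteq> A k" if "j \<le> k" for j k
  proof -
    have "t j \<le> t k"
      using that e by (simp add: t_def)
    then show ?thesis
      unfolding A_def by (intro interior_of_mono closure_of_mono) (auto simp: L_def)
  qed
  have A_le: "F x \<le> t k" if "x \<in> A k" for x k
  proof -
    have "closedin T {x \<in> topspace T. F x \<in> {..t k}}"
      using F by (intro closedin_continuous_map_preimage) auto
    then have "T closure_of (L k) \<subseteq> {x \<in> topspace T. F x \<in> {..t k}}"
      by (intro closure_of_minimal) (auto simp: L_def)
    then show ?thesis
      using that interior_of_subset[of T "T closure_of (L k)"] by (auto simp: A_def)
  qed
  have "L 0 = {}"
    using B by (fastforce simp: L_def t_def)
  then have A0: "A 0 = {}"
    by (simp add: A_def)
  have "B < t N"
    using N e by (simp add: t_def field_simps)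
  then have "L N = topspace T"
    using B by (fastforce simp: L_def)
  then have AN: "A N = topspace T"
    by (simp add: A_def)
  define P where "P k = A (Suc k) - T closure_of (A k)" for k
  have A_cl: "A k \<subseteq> T closure_of (A k)" for k
    by (rule regular_opensD(4)[OF A_reg])
  have P_disj: "P j \<inter> P k = {}" if "j < k" for j k
  proof -
    have "P j \<subseteq> A k"
      using mono[of "Suc j" k] that by (auto simp: P_def)
    then show ?thesis
      using A_cl[of k] by (auto simp: P_def)
  qed
  have "regular_partition T (P ` {..<N})"
  proof (rule regular_partitionI)
    show "P ` {..<N} \<subseteq> regular_opens T"
      using regular_opens_Diff_closure[OF A_reg regular_opensD(1)[OF A_reg]] by (auto simp: P_def)
    show "disjoint (P ` {..<N})"
      unfolding disjoint_def by (metis (no_types, lifting) P_disj imageE inf_commute linorder_neqE_nat)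
    show "\<exists>R\<in>P ` {..<N}. R \<inter> U \<noteq> {}" if U: "openin T U" "U \<noteq> {}" for U
    proof -
      \<comment> \<open>Some \<open>k\<close> is the last index before \<open>U\<close> starts to
        meet the increasing sets \<open>A k\<close>; being open, \<open>U\<close> then also misses
        the closure of \<open>A k\<close>.\<close>
      have "U \<inter> A N \<noteq> {}" "\<not> U \<inter> A 0 \<noteq> {}"
        using U openin_subset[OF U(1)] AN A0 by auto
      then obtain k where k: "k < N" "\<not> U \<inter> A k \<noteq> {}" "U \<inter> A (Suc k) \<noteq> {}"
        using ex_least_nat_less[of "\<lambda>k. U \<inter> A k \<noteq> {}" N] by auto
      have "U \<inter> T closure_of (A k) = {}"
        using k openin_Int_closure_of_eq_empty[OF U(1), of "A k"] by simp
      then have "P k \<inter> U \<noteq> {}"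
        using k by (auto simp: P_def)
      then show ?thesis
        using k(1) by blast
    qed
  qed simp
  moreover have "t k \<le> F x \<and> F x \<le> t k + e" if x: "x \<in> P k" for x k
  proof
    have "x \<in> topspace T" "x \<notin> A k" "x \<in> A (Suc k)"
      using x A_cl[of k] regular_opensD(2)[OF A_reg[of "Suc k"]] by (auto simp: P_def)
    then show "t k \<le> F x"
      using L_A[of k] by (force simp: L_def)
    show "F x \<le> t k + e"
      using A_le[OF \<open>x \<in> A (Suc k)\<close>] by (simp add: t_def algebra_simps)
  qed
  then have "\<forall>R\<in>P ` {..<N}. \<exists>c. \<forall>x\<in>R. c \<le> F x \<and> F x \<le> c + e"
    by blast
  ultimately show ?thesis
    by blast
qed

section \<open>Regular open sets of a dense subspace and of its compactification\<close>

locale compactified =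
  fixes X Y :: "'a topology"
  assumes compactification: "compactification X Y"
begin

lemma compact: "compact_space Y" and Hausdorff: "Hausdorff_space Y"
  and subspace: "topspace X \<subseteq> topspace Y" and topology: "X = subtopology Y (topspace X)"
  and dense: "Y closure_of (topspace X) = topspace Y"
  using compactification by (auto simp: compactification_def)

lemma openin_X: "openin X A \<longleftrightarrow> (\<exists>U. openin Y U \<and> A = U \<inter> topspace X)"
  by (subst topology) (auto simp: openin_subtopology)

lemma closure_X: "A \<subseteq> topspace X \<Longrightarrow> X closure_of A = topspace X \<inter> Y closure_of A"
  by (subst topology) (auto simp: closure_of_subtopology Int_absorb1)

lemma closure_open_Int_X:
  assumes "openin Y U"
  shows "Y closure_of (U \<inter> topspace X) = Y closure_of U"
  using dense openin_subset[OF assms] assms by (simp add: closure_of_openin_Int_superset)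

text \<open>By density \<open>U\<close> and its trace have the same closure in \<open>Y\<close>, so
  regularisation commutes with traces. Joins, partitions and contents pass between \<open>X\<close>
  and \<open>Y\<close> through this identity.\<close>

lemma regularize_Int_X:
  assumes U: "openin Y U"
  shows "X interior_of (X closure_of (U \<inter> topspace X)) = Y interior_of (Y closure_of U) \<inter> topspace X"
proof
  have cl: "X closure_of (U \<inter> topspace X) = topspace X \<inter> Y closure_of U"
    using closure_X[of "U \<inter> topspace X"] closure_open_Int_X[OF U] by simp
  have "openin X (Y interior_of (Y closure_of U) \<inter> topspace X)"
    unfolding openin_X by (rule exI[of _ "Y interior_of (Y closure_of U)"]) simp
  moreover have "Y interior_of (Y closure_of U) \<inter> topspace X \<subseteq> topspace X \<inter> Y closure_of U"
    using interior_of_subset[of Y "Y closure_of U"] by auto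
  ultimately show "Y interior_of (Y closure_of U) \<inter> topspace X \<subseteq> X interior_of (X closure_of (U \<inter> topspace X))"
    unfolding cl by (intro interior_of_maximal)
  \<comment> \<open>Density is used a second time: \<open>V\<close> lies in the closure of its own
    trace, hence in the closure of \<open>U\<close>.\<close>
  obtain V where V: "openin Y V" "X interior_of (X closure_of (U \<inter> topspace X)) = V \<inter> topspace X"
    using openin_X openin_interior_of by metis
  have "V \<inter> topspace X \<subseteq> Y closure_of U"
    using V(2) interior_of_subset[of X "X closure_of (U \<inter> topspace X)"] unfolding cl by auto
  then have "Y closure_of (V \<inter> topspace X) \<subseteq> Y closure_of U"
    by (intro closure_of_minimal) auto
  then have "V \<subseteq> Y closure_of U"
    using closure_open_Int_X[OF V(1)] closure_of_subset[OF openin_subset[OF V(1)]] by simp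
  then have "V \<subseteq> Y interior_of (Y closure_of U)"
    using V(1) by (rule interior_of_maximal)
  then show "X interior_of (X closure_of (U \<inter> topspace X)) \<subseteq> Y interior_of (Y closure_of U) \<inter> topspace X"
    using V(2) by auto
qed

lemma regular_opens_Int_X:
  assumes "P \<in> regular_opens Y"
  shows "P \<inter> topspace X \<in> regular_opens X"
  using interior_closure_in_regular_opens[of X "P \<inter> topspace X"]
    regularize_Int_X[OF regular_opensD(1)[OF assms]] regular_opensD(3)[OF assms] by simp

abbreviation "ext \<equiv> regular_extension X Y"

lemma regular_extension:
  assumes "R \<in> regular_opens X"
  shows "ext R \<in> regular_opens Y" "ext R \<inter> topspace X = R"
  using theI'[OF regular_extension_ex1[OF compactification assms]] by (simp_all add: regular_extension_def)

lemma regular_extension_Int_X: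
  assumes "P \<in> regular_opens Y"
  shows "ext (P \<inter> topspace X) = P"
  using the1_equality[OF regular_extension_ex1[OF compactification regular_opens_Int_X[OF assms]], of P] assms
  by (simp add: regular_extension_def)

lemma Int_X_inject:
  assumes "P \<in> regular_opens Y" "Q \<in> regular_opens Y" "P \<inter> topspace X = Q \<inter> topspace X"
  shows "P = Q"
  using regular_extension_Int_X assms by metis

lemma inj_on_Int_X: "\<P> \<subseteq> regular_opens Y \<Longrightarrow> inj_on (\<lambda>P. P \<inter> topspace X) \<P>"
  by (meson inj_onI Int_X_inject subsetD)

lemma inj_on_regular_extension: "\<P> \<subseteq> regular_opens X \<Longrightarrow> inj_on ext \<P>"
  by (rule inj_onI) (metis regular_extension(2) subsetD)

lemma regular_join_Int_X:
  assumes "\<P> \<subseteq> regular_opens Y"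
  shows "regular_join X ((\<lambda>P. P \<inter> topspace X) ` \<P>) = regular_join Y \<P> \<inter> topspace X"
proof -
  have "\<Union>((\<lambda>P. P \<inter> topspace X) ` \<P>) = \<Union>\<P> \<inter> topspace X"
    by auto
  moreover have "openin Y (\<Union>\<P>)"
    using assms regular_opensD(1) by blast
  ultimately show ?thesis
    by (simp add: regular_join_def regularize_Int_X)
qed

lemma disjoint_Int_X: "disjoint \<P> \<Longrightarrow> disjoint ((\<lambda>P. P \<inter> topspace X) ` \<P>)"
  unfolding disjoint_def by blast

lemma content_on_Int_X:
  assumes \<mu>: "content_on X \<mu>"
  shows "content_on Y (\<lambda>P. \<mu> (P \<inter> topspace X))"
  unfolding content_on_def
proof (intro conjI allI impI ballI)
  show "0 \<le> \<mu> (R \<inter> topspace X)" if "R \<in> regular_opens Y" for R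
    by (rule content_on_nonneg[OF \<mu> regular_opens_Int_X[OF that]])
  fix \<P> assume P: "finite \<P> \<and> \<P> \<subseteq> regular_opens Y \<and> disjoint \<P>"
  have "\<mu> (regular_join Y \<P> \<inter> topspace X) = (\<Sum>R\<in>(\<lambda>P. P \<inter> topspace X) ` \<P>. \<mu> R)"
    using P disjoint_Int_X[of \<P>] regular_opens_Int_X
      content_on_regular_join[OF \<mu>, of "(\<lambda>P. P \<inter> topspace X) ` \<P>"]
    by (auto simp: regular_join_Int_X image_subset_iff)
  then show "\<mu> (regular_join Y \<P> \<inter> topspace X) = (\<Sum>R\<in>\<P>. \<mu> (R \<inter> topspace X))"
    using P by (simp add: sum.reindex inj_on_Int_X)
qed

lemma regular_partition_Int_X:
  assumes "regular_partition Y \<P>"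
  shows "regular_partition X ((\<lambda>P. P \<inter> topspace X) ` \<P>)"
  using assms disjoint_Int_X[of \<P>] regular_join_Int_X[of \<P>] subspace regular_opens_Int_X
  by (auto simp: regular_partition_def Int_absorb1)

text \<open>Join and disjointness are checked on traces and lifted back, since a regular open set of
  \<open>Y\<close> is determined by its trace.\<close>

lemma regular_partition_regular_extension:
  assumes Q: "regular_partition X \<Q>"
  shows "regular_partition Y (ext ` \<Q>)"
proof -
  have fin: "finite \<Q>" and reg: "\<Q> \<subseteq> regular_opens X" and disj: "disjoint \<Q>"
    and join: "regular_join X \<Q> = topspace X"
    using Q by (auto simp: regular_partition_def)
  have regY: "ext ` \<Q> \<subseteq> regular_opens Y"
    using reg regular_extension(1) by auto
  have "(\<lambda>P. P \<inter> topspace X) ` ext ` \<Q> = \<Q>"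
    using reg regular_extension(2) by (force simp: image_image)
  then have "regular_join Y (ext ` \<Q>) \<inter> topspace X = topspace Y \<inter> topspace X"
    using regular_join_Int_X[OF regY] join subspace by auto
  then have "regular_join Y (ext ` \<Q>) = topspace Y"
    by (rule Int_X_inject[OF regular_join_in_regular_opens topspace_in_regular_opens])
  moreover have "disjoint (ext ` \<Q>)"
    unfolding disjoint_def
  proof (intro ballI impI)
    fix A B assume "A \<in> ext ` \<Q>" "B \<in> ext ` \<Q>" "A \<noteq> B"
    then obtain P R where PR: "P \<in> \<Q>" "R \<in> \<Q>" "P \<noteq> R" "A = ext P" "B = ext R"
      by blast
    then have "(A \<inter> B) \<inter> topspace X = P \<inter> R"
      using reg regular_extension(2)[of P] regular_extension(2)[of R] by blast
    also have "\<dots> = {} \<inter> topspace X"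
      using disj PR by (auto simp: disjoint_def)
    finally show "A \<inter> B = {}"
      using regY \<open>A \<in> ext ` \<Q>\<close> \<open>B \<in> ext ` \<Q>\<close>
      by (intro Int_X_inject[of "A \<inter> B" "{}"] regular_opens_Int) auto
  qed
  ultimately show ?thesis
    using fin regY by (simp add: regular_partition_def)
qed

lemma fun_extension:
  assumes "f \<in> extendable_functions X Y"
  shows "continuous_map Y euclideanreal (fun_extension X Y f)"
    and "x \<in> topspace X \<Longrightarrow> fun_extension X Y f x = f x"
proof -
  have ext: "continuous_map Y euclideanreal (fun_extension X Y f) \<and>
      fun_extension X Y f \<in> extensional (topspace Y) \<and> restrict (fun_extension X Y f) (topspace X) = f"
    unfolding fun_extension_def by (rule theI'[OF fun_extension_ex1[OF compactification assms]])
  then show "continuous_map Y euclideanreal (fun_extension X Y f)"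
    by blast
  show "fun_extension X Y f x = f x" if "x \<in> topspace X"
    using ext that by (metis restrict_apply')
qed

end

section \<open>The integral against the content as an integral over the compactification\<close>

locale compactified_content = compactified +
  fixes \<mu> :: "'a set \<Rightarrow> real"
  assumes content_X: "content_on X \<mu>"
begin

abbreviation "m \<equiv> \<lambda>P. \<mu> (P \<inter> topspace X)"

sublocale regular_content Y m
  using compact Hausdorff content_on_Int_X[OF content_X] by unfold_locales

text \<open>On each cell the comparison with \<open>F\<close> is known only on
  \<open>P \<inter> R\<close>, inside \<open>X\<close>; this set is dense in
  \<open>ext P \<inter> ext R\<close>, which is enough for
  \<open>integral_content_part_ge\<close>.\<close>

lemma simple_integral_le:
  assumes R: "R \<in> regular_opens X" and F: "continuous_map Y euclideanreal F"
    and s: "simple_wrt X s \<Q> r" and le: "\<And>x. x \<in> R \<Longrightarrow> s x \<le> F x"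
  shows "simple_integral X \<mu> R s \<le> (LINT x|content_part Y m (ext R). F x)"
proof -
  have Q: "regular_partition X \<Q>" and reg: "\<Q> \<subseteq> regular_opens X"
    using s by (auto simp: simple_wrt_def regular_partition_def)
  note extR = regular_extension[OF R]
  have "simple_integral X \<mu> R s = (\<Sum>P\<in>\<Q>. r P * \<mu> (P \<inter> R))"
    by (rule simple_integral_eq[OF content_X R s])
  also have "\<dots> \<le> (\<Sum>P\<in>\<Q>. LINT x|content_part Y m (ext P \<inter> ext R). F x)"
  proof (rule sum_mono)
    fix P assume P: "P \<in> \<Q>"
    note extP = regular_extension[OF subsetD[OF reg P]]
    have PR: "ext P \<inter> ext R \<in> regular_opens Y"
      by (rule regular_opens_Int[OF extP(1) extR(1)])
    have eq: "(ext P \<inter> ext R) \<inter> topspace X = P \<inter> R"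
      using extP(2) extR(2) by blast
    have "r P * m (ext P \<inter> ext R) \<le> (LINT x|content_part Y m (ext P \<inter> ext R). F x)"
    proof (rule integral_content_part_ge[OF PR F, where S="P \<inter> R"])
      show "ext P \<inter> ext R \<subseteq> Y closure_of (P \<inter> R)"
        using closure_open_Int_X[OF regular_opensD(1)[OF PR]] regular_opensD(4)[OF PR] by (simp add: eq)
      show "P \<inter> R \<subseteq> topspace Y"
        using eq subspace by auto
      show "r P \<le> F x" if "x \<in> P \<inter> R" for x
        using that le[of x] s P by (auto simp: simple_wrt_def)
    qed
    then show "r P * \<mu> (P \<inter> R) \<le> (LINT x|content_part Y m (ext P \<inter> ext R). F x)"
      by (simp add: eq)
  qed
  also have "\<dots> = (\<Sum>P\<in>ext ` \<Q>. LINT x|content_part Y m (P \<inter> ext R). F x)"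
    by (simp add: sum.reindex[OF inj_on_regular_extension[OF reg]])
  also have "\<dots> = (LINT x|content_part Y m (ext R). F x)"
    by (rule integral_content_part_split[OF regular_partition_regular_extension[OF Q] F extR(1), symmetric])
  finally show ?thesis .
qed

text \<open>\<open>s\<close> takes the lower level on cells where \<open>F\<close> varies by at most
  \<open>e\<close>; each cell loses at most \<open>e\<close> times its content within
  \<open>R\<close>, and these contents add up to \<open>\<mu> R\<close>.\<close>

lemma simple_integral_approx:
  assumes R: "R \<in> regular_opens X" and F: "continuous_map Y euclideanreal F" and e: "0 < e"
  obtains s where "bounded_simple X s" "\<And>x. x \<in> topspace X \<Longrightarrow> s x \<le> F x"
    "(LINT x|content_part Y m (ext R). F x) \<le> simple_integral X \<mu> R s + e * \<mu> R"
proof -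
  obtain B where B: "0 < B" "\<And>x. x \<in> topspace Y \<Longrightarrow> \<bar>F x\<bar> < B"
    using compact_space_continuous_bounded[OF compact F] by blast
  obtain \<P> where P: "regular_partition Y \<P>" and "\<forall>P\<in>\<P>. \<exists>c. \<forall>x\<in>P. c \<le> F x \<and> F x \<le> c + e"
    using level_set_regular_partition[OF compact F e] by blast
  then obtain c where c: "\<And>P x. P \<in> \<P> \<Longrightarrow> x \<in> P \<Longrightarrow> c P \<le> F x \<and> F x \<le> c P + e"
    by metis
  have fin: "finite \<P>" and reg: "\<P> \<subseteq> regular_opens Y" and disj: "disjoint \<P>"
    using P by (auto simp: regular_partition_def)
  \<comment> \<open>The default \<open>- B\<close> lies below \<open>F\<close>: admissibility in
    \<open>content_integral\<close> is also tested at points that no cell covers.\<close>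
  define s where "s x = (if \<exists>P\<in>\<P>. x \<in> P then c (THE P. P \<in> \<P> \<and> x \<in> P) else - B)" for x
  have s_in: "s x = c P" if "P \<in> \<P>" "x \<in> P" for P x
  proof -
    have "(THE P. P \<in> \<P> \<and> x \<in> P) = P"
      using that disj by (intro the_equality) (auto simp: disjoint_def)
    then show ?thesis
      using that by (auto simp: s_def)
  qed
  let ?r = "\<lambda>Q. c (ext Q)"
  let ?\<Q> = "(\<lambda>P. P \<inter> topspace X) ` \<P>"
  have extP: "ext (P \<inter> topspace X) = P" if "P \<in> \<P>" for P
    using that reg regular_extension_Int_X by auto
  have simple: "simple_wrt X s ?\<Q> ?r"
    unfolding simple_wrt_def using regular_partition_Int_X[OF P] by (auto simp: extP s_in)
  have "s ` topspace X \<subseteq> insert (- B) (c ` \<P>)"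
  proof (rule image_subsetI)
    fix x
    show "s x \<in> insert (- B) (c ` \<P>)"
    proof (cases "\<exists>P\<in>\<P>. x \<in> P")
      case True
      then show ?thesis
        using s_in by auto
    next
      case False
      then show ?thesis
        by (simp add: s_def)
    qed
  qed
  then have "bounded (s ` topspace X)"
    using fin by (intro finite_imp_bounded) (auto intro: finite_subset)
  show ?thesis
  proof
    show "bounded_simple X s"
      unfolding bounded_simple_def using simple \<open>bounded (s ` topspace X)\<close> by blast
    show "s x \<le> F x" if "x \<in> topspace X" for x
    proof (cases "\<exists>P\<in>\<P>. x \<in> P")
      case True
      then show ?thesis
        using s_in c by force
    next
      case False
      then have "s x = - B"
        by (simp add: s_def)
      then show ?thesis
        using B(2)[of x] that subspace by auto
    qed
    note extR = regular_extension[OF R]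
    have PR: "P \<inter> ext R \<in> regular_opens Y" if "P \<in> \<P>" for P
      using that reg extR(1) by (auto intro: regular_opens_Int)
    have PR_eq: "m (P \<inter> ext R) = \<mu> (P \<inter> topspace X \<inter> R)" for P
      using extR(2) by (metis Int_assoc Int_commute inf.right_idem)
    have "(LINT x|content_part Y m (ext R). F x) = (\<Sum>P\<in>\<P>. LINT x|content_part Y m (P \<inter> ext R). F x)"
      by (rule integral_content_part_split[OF P F extR(1)])
    also have "\<dots> \<le> (\<Sum>P\<in>\<P>. (c P + e) * m (P \<inter> ext R))"
      using c by (intro sum_mono integral_content_part_le[OF PR F]) auto
    also have "\<dots> = (\<Sum>P\<in>\<P>. c P * m (P \<inter> ext R)) + e * (\<Sum>P\<in>\<P>. m (P \<inter> ext R))"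
      by (simp add: distrib_right sum.distrib sum_distrib_left)
    also have "(\<Sum>P\<in>\<P>. m (P \<inter> ext R)) = \<mu> R"
      using content_on_partition[OF content P extR(1)] extR(2) by simp
    also have "(\<Sum>P\<in>\<P>. c P * m (P \<inter> ext R)) = simple_integral X \<mu> R s"
      unfolding simple_integral_eq[OF content_X R simple] PR_eq
      by (subst sum.reindex[OF inj_on_Int_X[OF reg]]) (simp add: extP)
    finally show "(LINT x|content_part Y m (ext R). F x) \<le> simple_integral X \<mu> R s + e * \<mu> R" .
  qed
qed

lemma content_integral_eq:
  assumes R: "R \<in> regular_opens X" and F: "continuous_map Y euclideanreal F"
    and f: "\<And>x. x \<in> topspace X \<Longrightarrow> F x = f x"
  shows "content_integral X \<mu> R f = (LINT x|content_part Y m (ext R). F x)"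
proof -
  let ?S = "{s. bounded_simple X s \<and> (\<forall>x\<in>R. s x \<le> f x)}" and ?I = "LINT x|content_part Y m (ext R). F x"
  have RX: "R \<subseteq> topspace X"
    by (rule regular_opensD(2)[OF R])
  have upper: "simple_integral X \<mu> R s \<le> ?I" if "s \<in> ?S" for s
  proof -
    obtain \<Q> r where "simple_wrt X s \<Q> r"
      using \<open>s \<in> ?S\<close> by (auto simp: bounded_simple_def)
    then show ?thesis
      using \<open>s \<in> ?S\<close> RX f by (intro simple_integral_le[OF R F]) (auto simp: subset_iff)
  qed
  then have bdd: "bdd_above (simple_integral X \<mu> R ` ?S)"
    by (rule bdd_aboveI2)
  have approx: "\<exists>s\<in>?S. ?I \<le> simple_integral X \<mu> R s + e * \<mu> R" if e: "0 < e" for e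
  proof -
    obtain s where "bounded_simple X s" "\<And>x. x \<in> topspace X \<Longrightarrow> s x \<le> F x"
      "?I \<le> simple_integral X \<mu> R s + e * \<mu> R"
      using simple_integral_approx[OF R F e] by blast
    then show ?thesis
      using RX f by (intro bexI[of _ s]) (auto simp: subset_iff)
  qed
  show ?thesis
    unfolding content_integral_def
  proof (rule antisym)
    have "?S \<noteq> {}"
      using approx[of 1] by auto
    then show "(SUP s\<in>?S. simple_integral X \<mu> R s) \<le> ?I"
      using upper by (rule cSUP_least)
    show "?I \<le> (SUP s\<in>?S. simple_integral X \<mu> R s)"
    proof (rule field_le_epsilon)
      fix e :: real assume e: "0 < e"
      \<comment> \<open>The added 1 keeps the divisor positive when \<open>\<mu> R\<close> vanishes,
        and the resulting error is at most \<open>e\<close>.\<close>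
      have pos: "0 < \<mu> R + 1"
        using content_on_nonneg[OF content_X R] by simp
      then obtain s where s: "s \<in> ?S" "?I \<le> simple_integral X \<mu> R s + e / (\<mu> R + 1) * \<mu> R"
        using approx[of "e / (\<mu> R + 1)"] e by auto
      have "e / (\<mu> R + 1) * \<mu> R \<le> e"
        using pos e by (simp add: field_simps)
      then show "?I \<le> (SUP s\<in>?S. simple_integral X \<mu> R s) + e"
        using s(2) cSUP_upper[OF s(1) bdd] by linarith
    qed
  qed
qed

end

theorem theorem7p2:
  fixes X Y :: "'a topology" and \<mu> :: "'a set \<Rightarrow> real"
  assumes "locally_compact_space X" and "Hausdorff_space X"
    and "content_on X \<mu>" and "\<mu> (topspace X) = 1"
    and "compactification X Y"
  shows "\<exists>\<nu> \<phi>.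
    represents_content X Y \<mu> \<nu> \<phi> \<and>
    (\<forall>\<nu>' \<phi>'. represents_content X Y \<mu> \<nu>' \<phi>' \<longrightarrow> \<nu>' = \<nu> \<and> same_density Y \<nu> \<phi>' \<phi>) \<and>
    (\<forall>R\<in>regular_opens X. \<forall>f\<in>extendable_functions X Y.
       let Q = regular_extension X Y R; F = fun_extension X Y f in
         content_integral X \<mu> R f =
           (LINT x:Q|\<nu>. F x) + (LINT x:Y frontier_of Q|\<nu>. F x * \<phi> Q x))"
proof -
  interpret compactified_content X Y \<mu>
    using assms by unfold_locales
  let ?\<nu> = "content_measure Y m" and ?\<phi> = "liminal_density Y m"
  have rep: "represents_content X Y \<mu> ?\<nu> ?\<phi>"
    unfolding represents_content_def Let_def
  proof (intro conjI ballI)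
    fix R assume R: "R \<in> regular_opens X"
    show "\<mu> R = measure ?\<nu> (ext R) + (LINT x:Y frontier_of (ext R)|?\<nu>. ?\<phi> (ext R) x)"
      using content_representation[OF regular_extension(1)[OF R]] regular_extension(2)[OF R] by simp
  qed (rule normal_borel_measure_content_measure liminal_density_structure_liminal_density)+
  have unique: "\<nu>' = ?\<nu> \<and> same_density Y ?\<nu> \<phi>' ?\<phi>" if "represents_content X Y \<mu> \<nu>' \<phi>'" for \<nu>' \<phi>'
  proof -
    have normal: "normal_borel_measure Y \<nu>'" and \<phi>': "liminal_density_structure Y \<nu>' \<phi>'"
      using that by (auto simp: represents_content_def)
    \<comment> \<open>\<open>represents_content\<close> speaks of extensions only, but every regular
      open set of \<open>Y\<close> is the extension of its trace.\<close>
    have rep': "m Q = measure \<nu>' Q + (LINT x:Y frontier_of Q|\<nu>'. \<phi>' Q x)" if Q: "Q \<in> regular_opens Y" for Q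
      using \<open>represents_content X Y \<mu> \<nu>' \<phi>'\<close> regular_opens_Int_X[OF Q] regular_extension_Int_X[OF Q]
      unfolding represents_content_def Let_def by metis
    \<comment> \<open>Finiteness of \<open>\<nu>'\<close> has to be derived. The whole space has
      empty frontier, so its \<open>measure\<close> is 1, whereas an infinite mass would make
      \<open>measure\<close> 0.\<close>
    have "measure \<nu>' (topspace Y) = 1"
      using rep'[of "topspace Y"] assms(4) subspace by (simp add: set_lebesgue_integral_def Int_absorb1)
    moreover have "space \<nu>' = topspace Y"
      using normal sets_eq_imp_space_eq[of \<nu>' "borel_of Y"] by (simp add: normal_borel_measure_def)
    ultimately have "finite_measure \<nu>'"
      by (intro finite_measureI) (auto simp: measure_def)
    from normal_representation_unique[OF normal this \<phi>' rep'] show ?thesis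
      by blast
  qed
  have integral: "content_integral X \<mu> R f = (LINT x:ext R|?\<nu>. fun_extension X Y f x) +
      (LINT x:Y frontier_of (ext R)|?\<nu>. fun_extension X Y f x * ?\<phi> (ext R) x)"
    if R: "R \<in> regular_opens X" and f: "f \<in> extendable_functions X Y" for R f
  proof -
    let ?F = "fun_extension X Y f"
    note F = fun_extension(1)[OF f] and extR = regular_extension(1)[OF R]
    have F_meas: "?F \<in> borel_measurable ?\<nu>"
      by (rule continuous_map_borel_measurable[OF F]) simp
    obtain B where B: "0 < B" "\<And>x. x \<in> topspace Y \<Longrightarrow> \<bar>?F x\<bar> < B"
      using compact_space_continuous_bounded[OF compact F] by blast
    have "content_integral X \<mu> R f = (LINT x|content_part Y m (ext R). ?F x)"
      by (rule content_integral_eq[OF R F fun_extension(2)[OF f]])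
    also have "\<dots> = (LINT x|?\<nu>. ?F x * full_density Y ?\<phi> (ext R) x)"
      by (rule integral_content_part[OF extR F_meas])
    also have "\<dots> = (LINT x:ext R|?\<nu>. ?F x) + (LINT x:Y frontier_of (ext R)|?\<nu>. ?F x * ?\<phi> (ext R) x)"
      using B by (intro integral_mult_full_density(2)[OF finite_measure_content_measure _
            liminal_density_structure_liminal_density extR F_meas, where B=B]) (auto intro: less_imp_le)
    finally show ?thesis .
  qed
  show ?thesis
    using rep unique integral unfolding Let_def by blast
qed

end
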